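(* Let $l$ be a positive integer and let $S$ be a finite (additively written) abelian group of order $2l+1$. Then $\mathcal{A}_S=\mathfrak{gl}_S$, and $\mathfrak{g}_S$ is isomorphic to $(\mathfrak{gl}_S)^{\tau}$, which is isomorphic to the simple Lie algebra of type $B_l$.
   Context: All algebras are over $\mathbb{C}$. $\mathfrak{g}_S$ is the Lie algebra with generators $d^{\alpha,\beta}$ ($\alpha,\beta\in S$), subject to $d^{-\alpha,\beta}=-d^{\alpha,\beta}$ and $$[d^{\alpha,\beta},d^{\mu,\nu}]=\delta_{\alpha+\mu,\nu-\beta}d^{\alpha+\mu,-\alpha+\nu}-\delta_{\alpha+\mu,\beta-\nu}d^{\alpha+\mu,\alpha+\nu}-\delta_{\alpha-\mu,\nu-\beta}d^{\alpha-\mu,\nu-\alpha}+\delta_{\alpha-\mu,\beta-\nu}d^{\alpha-\mu,\alpha+\nu}.$$ $\mathfrak{gl}_S$ is the associative algebra with basis $E_{\alpha,\beta}$ ($\alpha,\beta\in S$) and product $E_{\alpha,\beta}\cdot E_{\mu,\nu}=\delta_{\beta,\mu}E_{\alpha,\nu}$, viewed also as a Lie algebra under the commutator. $\tau$ is the order-2 Lie algebra automorphism of $\mathfrak{gl}_S$ with $\tau(E_{\alpha,\beta})=-E_{\beta,\alpha}$, and $(\mathfrak{gl}_S)^\tau$ is its fixed-point Lie subalgebra. $\mathcal{A}_S=\mathrm{span}\{E_{\alpha+\beta,\beta-\alpha}\mid\alpha,\beta\in S\}\subset\mathfrak{gl}_S$. *)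

theory Defs
  imports "HOL-Analysis.Analysis"
begin

section \<open>Complex Lie algebras\<close>

record 'a lie_alg =
  lie_carrier :: "'a set"
  lie_scale :: "complex \<Rightarrow> 'a \<Rightarrow> 'a"
  lie_bracket :: "'a \<Rightarrow> 'a \<Rightarrow> 'a"

text \<open>The carrier is a subspace of an ambient complex vector space, whose addition is the one of
  the type; the bracket is constrained on the carrier only.\<close>

definition lie_algebra :: "'a::ab_group_add lie_alg \<Rightarrow> bool" where
  "lie_algebra L \<longleftrightarrow>
     vector_space (lie_scale L) \<and>
     module.subspace (lie_scale L) (lie_carrier L) \<and>
     (\<forall>x\<in>lie_carrier L. \<forall>y\<in>lie_carrier L. lie_bracket L x y \<in> lie_carrier L) \<and>
     (\<forall>x\<in>lie_carrier L. \<forall>y\<in>lie_carrier L. \<forall>z\<in>lie_carrier L.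
        lie_bracket L (x + y) z = lie_bracket L x z + lie_bracket L y z \<and>
        lie_bracket L x (y + z) = lie_bracket L x y + lie_bracket L x z) \<and>
     (\<forall>c. \<forall>x\<in>lie_carrier L. \<forall>y\<in>lie_carrier L.
        lie_bracket L (lie_scale L c x) y = lie_scale L c (lie_bracket L x y) \<and>
        lie_bracket L x (lie_scale L c y) = lie_scale L c (lie_bracket L x y)) \<and>
     (\<forall>x\<in>lie_carrier L. lie_bracket L x x = 0) \<and>
     (\<forall>x\<in>lie_carrier L. \<forall>y\<in>lie_carrier L. \<forall>z\<in>lie_carrier L.
        lie_bracket L x (lie_bracket L y z) + lie_bracket L y (lie_bracket L z x)
          + lie_bracket L z (lie_bracket L x y) = 0)"

definition lie_isomorphic :: "'a::ab_group_add lie_alg \<Rightarrow> 'b::ab_group_add lie_alg \<Rightarrow> bool" where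
  "lie_isomorphic L M \<longleftrightarrow>
     lie_algebra L \<and> lie_algebra M \<and>
     (\<exists>f. bij_betw f (lie_carrier L) (lie_carrier M) \<and>
        (\<forall>x\<in>lie_carrier L. \<forall>y\<in>lie_carrier L. f (x + y) = f x + f y) \<and>
        (\<forall>c. \<forall>x\<in>lie_carrier L. f (lie_scale L c x) = lie_scale M c (f x)) \<and>
        (\<forall>x\<in>lie_carrier L. \<forall>y\<in>lie_carrier L.
           f (lie_bracket L x y) = lie_bracket M (f x) (f y)))"

abbreviation lie_span :: "'a::ab_group_add lie_alg \<Rightarrow> 'a set \<Rightarrow> 'a set" where
  "lie_span L \<equiv> module.span (lie_scale L)"

definition lie_product :: "'a::ab_group_add lie_alg \<Rightarrow> 'a set \<Rightarrow> 'a set \<Rightarrow> 'a set" where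
  "lie_product L A B = lie_span L {lie_bracket L x y | x y. x \<in> A \<and> y \<in> B}"

definition lie_ideal :: "'a::ab_group_add lie_alg \<Rightarrow> 'a set \<Rightarrow> bool" where
  "lie_ideal L I \<longleftrightarrow>
     I \<subseteq> lie_carrier L \<and> module.subspace (lie_scale L) I \<and>
     (\<forall>x\<in>lie_carrier L. \<forall>y\<in>I. lie_bracket L x y \<in> I)"

definition lie_simple :: "'a::ab_group_add lie_alg \<Rightarrow> bool" where
  "lie_simple L \<longleftrightarrow>
     lie_algebra L \<and>
     (\<exists>x\<in>lie_carrier L. \<exists>y\<in>lie_carrier L. lie_bracket L x y \<noteq> 0) \<and>
     (\<forall>I. lie_ideal L I \<longrightarrow> I = {0} \<or> I = lie_carrier L)"

definition lie_finite_dimensional :: "'a::ab_group_add lie_alg \<Rightarrow> bool" where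
  "lie_finite_dimensional L \<longleftrightarrow> (\<exists>B. finite B \<and> lie_carrier L = lie_span L B)"

section \<open>Cartan subalgebras, roots and Cartan matrices\<close>

fun lower_central :: "'a::ab_group_add lie_alg \<Rightarrow> 'a set \<Rightarrow> nat \<Rightarrow> 'a set" where
  "lower_central L H 0 = H"
| "lower_central L H (Suc n) = lie_product L H (lower_central L H n)"

definition cartan_subalgebra :: "'a::ab_group_add lie_alg \<Rightarrow> 'a set \<Rightarrow> bool" where
  "cartan_subalgebra L H \<longleftrightarrow>
     H \<subseteq> lie_carrier L \<and> module.subspace (lie_scale L) H \<and>
     (\<forall>x\<in>H. \<forall>y\<in>H. lie_bracket L x y \<in> H) \<and>
     (\<exists>n. lower_central L H n = {0}) \<and>
     {x \<in> lie_carrier L. \<forall>h\<in>H. lie_bracket L x h \<in> H} = H"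

text \<open>Functionals on \<open>H\<close> are functions on the ambient type of which only the values
  on \<open>H\<close> are used. Root spaces are taken as plain (not generalized) eigenspaces, which is the
  usual definition for a semisimple algebra.\<close>

definition root_space :: "'a::ab_group_add lie_alg \<Rightarrow> 'a set \<Rightarrow> ('a \<Rightarrow> complex) \<Rightarrow> 'a set" where
  "root_space L H \<alpha> =
     {x \<in> lie_carrier L. \<forall>h\<in>H. lie_bracket L h x = lie_scale L (\<alpha> h) x}"

definition is_root :: "'a::ab_group_add lie_alg \<Rightarrow> 'a set \<Rightarrow> ('a \<Rightarrow> complex) \<Rightarrow> bool" where
  "is_root L H \<alpha> \<longleftrightarrow>
     (\<forall>x\<in>H. \<forall>y\<in>H. \<alpha> (x + y) = \<alpha> x + \<alpha> y) \<and>
     (\<forall>c. \<forall>x\<in>H. \<alpha> (lie_scale L c x) = c * \<alpha> x) \<and>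
     (\<exists>h\<in>H. \<alpha> h \<noteq> 0) \<and>
     root_space L H \<alpha> \<noteq> {0}"

definition root_base ::
  "'a::ab_group_add lie_alg \<Rightarrow> 'a set \<Rightarrow> nat \<Rightarrow> (nat \<Rightarrow> 'a \<Rightarrow> complex) \<Rightarrow> bool" where
  "root_base L H l \<alpha> \<longleftrightarrow>
     (\<forall>i<l. is_root L H (\<alpha> i)) \<and>
     (\<forall>c :: nat \<Rightarrow> complex.
        (\<forall>h\<in>H. (\<Sum>i<l. c i * \<alpha> i h) = 0) \<longrightarrow> (\<forall>i<l. c i = 0)) \<and>
     (\<forall>\<beta>. is_root L H \<beta> \<longrightarrow>
        (\<exists>k :: nat \<Rightarrow> nat.
           (\<forall>h\<in>H. \<beta> h = (\<Sum>i<l. of_nat (k i) * \<alpha> i h)) \<or>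
           (\<forall>h\<in>H. \<beta> h = - (\<Sum>i<l. of_nat (k i) * \<alpha> i h))))"

definition is_coroot ::
  "'a::ab_group_add lie_alg \<Rightarrow> 'a set \<Rightarrow> ('a \<Rightarrow> complex) \<Rightarrow> 'a \<Rightarrow> bool" where
  "is_coroot L H \<alpha> h \<longleftrightarrow>
     h \<in> H \<and> h \<in> lie_product L (root_space L H \<alpha>) (root_space L H (\<lambda>x. - \<alpha> x)) \<and> \<alpha> h = 2"

definition simple_of_cartan_type ::
  "(nat \<Rightarrow> nat \<Rightarrow> int) \<Rightarrow> nat \<Rightarrow> 'a::ab_group_add lie_alg \<Rightarrow> bool" where
  "simple_of_cartan_type A l L \<longleftrightarrow>
     lie_simple L \<and> lie_finite_dimensional L \<and>
     (\<exists>H \<alpha> t. cartan_subalgebra L H \<and> root_base L H l \<alpha> \<and>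
        (\<forall>i<l. is_coroot L H (\<alpha> i) (t i)) \<and>
        (\<forall>i<l. \<forall>j<l. \<alpha> i (t j) = of_int (A i j)))"

text \<open>Simple roots are numbered from \<open>0\<close> to \<open>l - 1\<close>, the last one being short; the entry
  \<open>(i, j)\<close> is the value of the \<open>i\<close>-th simple root on the \<open>j\<close>-th simple coroot, so the entry
  \<open>-2\<close> sits in the last column. For \<open>l = 1\<close> the matrix is \<open>(2)\<close>.\<close>

definition cartan_matrix_B :: "nat \<Rightarrow> nat \<Rightarrow> nat \<Rightarrow> int" where
  "cartan_matrix_B l i j =
     (if i = j then 2
      else if Suc i = j then (if Suc j = l then -2 else -1)
      else if i = Suc j then -1
      else 0)"

definition simple_of_type_B :: "nat \<Rightarrow> 'a::ab_group_add lie_alg \<Rightarrow> bool" where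
  "simple_of_type_B l L \<longleftrightarrow> simple_of_cartan_type (cartan_matrix_B l) l L"

section \<open>Lie algebras given by generators and relations\<close>

datatype 'x lie_expr =
    Gen 'x
  | Zero
  | Plus "'x lie_expr" "'x lie_expr"
  | Neg "'x lie_expr"
  | Scale complex "'x lie_expr"
  | Bracket "'x lie_expr" "'x lie_expr"

text \<open>The congruence on formal expressions generated by the axioms of complex Lie algebras and the
  relations \<open>R\<close>; its quotient is the complex Lie algebra presented by \<open>R\<close>.\<close>

inductive lie_eq :: "('x lie_expr \<times> 'x lie_expr) set \<Rightarrow> 'x lie_expr \<Rightarrow> 'x lie_expr \<Rightarrow> bool"
  for R where
  rel: "(s, t) \<in> R \<Longrightarrow> lie_eq R s t"
| refl: "lie_eq R s s"
| sym: "lie_eq R s t \<Longrightarrow> lie_eq R t s"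
| trans: "lie_eq R s t \<Longrightarrow> lie_eq R t u \<Longrightarrow> lie_eq R s u"
| cong_plus: "lie_eq R s s' \<Longrightarrow> lie_eq R t t' \<Longrightarrow> lie_eq R (Plus s t) (Plus s' t')"
| cong_neg: "lie_eq R s s' \<Longrightarrow> lie_eq R (Neg s) (Neg s')"
| cong_scale: "lie_eq R s s' \<Longrightarrow> lie_eq R (Scale c s) (Scale c s')"
| cong_bracket: "lie_eq R s s' \<Longrightarrow> lie_eq R t t' \<Longrightarrow> lie_eq R (Bracket s t) (Bracket s' t')"
| plus_assoc: "lie_eq R (Plus (Plus s t) u) (Plus s (Plus t u))"
| plus_comm: "lie_eq R (Plus s t) (Plus t s)"
| plus_zero: "lie_eq R (Plus Zero s) s"
| plus_neg: "lie_eq R (Plus (Neg s) s) Zero"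
| scale_plus: "lie_eq R (Scale c (Plus s t)) (Plus (Scale c s) (Scale c t))"
| scale_add: "lie_eq R (Scale (c + d) s) (Plus (Scale c s) (Scale d s))"
| scale_scale: "lie_eq R (Scale c (Scale d s)) (Scale (c * d) s)"
| scale_one: "lie_eq R (Scale 1 s) s"
| bracket_plus_left: "lie_eq R (Bracket (Plus s t) u) (Plus (Bracket s u) (Bracket t u))"
| bracket_plus_right: "lie_eq R (Bracket s (Plus t u)) (Plus (Bracket s t) (Bracket s u))"
| bracket_scale_left: "lie_eq R (Bracket (Scale c s) t) (Scale c (Bracket s t))"
| bracket_scale_right: "lie_eq R (Bracket s (Scale c t)) (Scale c (Bracket s t))"
| bracket_self: "lie_eq R (Bracket s s) Zero"
| jacobi: "lie_eq R (Plus (Plus (Bracket s (Bracket t u)) (Bracket t (Bracket u s)))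
                         (Bracket u (Bracket s t))) Zero"

lemma equivp_lie_eq: "equivp (lie_eq R)"
  by (rule equivpI) (auto intro: reflpI sympI transpI lie_eq.refl lie_eq.sym lie_eq.trans)

section \<open>The Lie algebra of generators \<open>d\<close>\<close>

definition d_expr :: "'s \<Rightarrow> 's \<Rightarrow> ('s \<times> 's) lie_expr" where
  "d_expr \<alpha> \<beta> = Gen (\<alpha>, \<beta>)"

definition delta_expr :: "'s \<Rightarrow> 's \<Rightarrow> 'x lie_expr \<Rightarrow> 'x lie_expr" where
  "delta_expr a b e = (if a = b then e else Zero)"

definition d_relations :: "(('s::ab_group_add \<times> 's) lie_expr \<times> ('s \<times> 's) lie_expr) set" where
  "d_relations =
     {(d_expr (-\<alpha>) \<beta>, Neg (d_expr \<alpha> \<beta>)) | \<alpha> \<beta>. True} \<union>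
     {(Bracket (d_expr \<alpha> \<beta>) (d_expr \<mu> \<nu>),
       Plus
        (Plus (delta_expr (\<alpha> + \<mu>) (\<nu> - \<beta>) (d_expr (\<alpha> + \<mu>) (-\<alpha> + \<nu>)))
              (Neg (delta_expr (\<alpha> + \<mu>) (\<beta> - \<nu>) (d_expr (\<alpha> + \<mu>) (\<alpha> + \<nu>)))))
        (Plus (Neg (delta_expr (\<alpha> - \<mu>) (\<nu> - \<beta>) (d_expr (\<alpha> - \<mu>) (\<nu> - \<alpha>))))
              (delta_expr (\<alpha> - \<mu>) (\<beta> - \<nu>) (d_expr (\<alpha> - \<mu>) (\<alpha> + \<nu>))))) | \<alpha> \<beta> \<mu> \<nu>. True}"

quotient_type (overloaded) 's g_type = "('s::ab_group_add \<times> 's) lie_expr" / "lie_eq d_relations"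
  by (rule equivp_lie_eq)

instantiation g_type :: (ab_group_add) ab_group_add
begin

lift_definition zero_g_type :: "'a g_type" is Zero .

lift_definition plus_g_type :: "'a g_type \<Rightarrow> 'a g_type \<Rightarrow> 'a g_type" is Plus
  by (rule lie_eq.cong_plus)

lift_definition uminus_g_type :: "'a g_type \<Rightarrow> 'a g_type" is Neg
  by (rule lie_eq.cong_neg)

definition minus_g_type :: "'a g_type \<Rightarrow> 'a g_type \<Rightarrow> 'a g_type" where
  "minus_g_type x y = x + (- y)"

instance
proof
  fix a b c :: "'a g_type"
  show "a + b + c = a + (b + c)" by transfer (rule lie_eq.plus_assoc)
  show "a + b = b + a" by transfer (rule lie_eq.plus_comm)
  show "0 + a = a" by transfer (rule lie_eq.plus_zero)
  show "- a + a = 0" by transfer (rule lie_eq.plus_neg)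
  show "a - b = a + - b" by (rule minus_g_type_def)
qed

end

lift_definition g_scale :: "complex \<Rightarrow> 's::ab_group_add g_type \<Rightarrow> 's g_type" is Scale
  by (rule lie_eq.cong_scale)

lift_definition g_bracket :: "'s::ab_group_add g_type \<Rightarrow> 's g_type \<Rightarrow> 's g_type" is Bracket
  by (rule lie_eq.cong_bracket)

lemma g_bracket_plus_left: "g_bracket (x + y) z = g_bracket x z + g_bracket y z"
  by transfer (rule lie_eq.bracket_plus_left)

lemma g_bracket_plus_right: "g_bracket x (y + z) = g_bracket x y + g_bracket x z"
  by transfer (rule lie_eq.bracket_plus_right)

lemma g_bracket_scale_left: "g_bracket (g_scale c x) y = g_scale c (g_bracket x y)"
  by transfer (rule lie_eq.bracket_scale_left)

lemma g_bracket_scale_right: "g_bracket x (g_scale c y) = g_scale c (g_bracket x y)"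
  by transfer (rule lie_eq.bracket_scale_right)

lemma g_bracket_self: "g_bracket x x = 0"
  by transfer (rule lie_eq.bracket_self)

lemma g_bracket_jacobi:
  "g_bracket x (g_bracket y z) + g_bracket y (g_bracket z x) + g_bracket z (g_bracket x y) = 0"
  by transfer (rule lie_eq.jacobi)

definition g_S :: "'s::ab_group_add g_type lie_alg" where
  "g_S = \<lparr>lie_carrier = UNIV, lie_scale = g_scale, lie_bracket = g_bracket\<rparr>"

lemma lie_algebra_g_S: "lie_algebra (g_S :: 's::ab_group_add g_type lie_alg)"
proof -
  have vs: "vector_space (g_scale :: complex \<Rightarrow> 's g_type \<Rightarrow> 's g_type)"
  proof
    fix c d :: complex and x y :: "'s g_type"
    show "g_scale c (x + y) = g_scale c x + g_scale c y" by transfer (rule lie_eq.scale_plus)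
    show "g_scale (c + d) x = g_scale c x + g_scale d x" by transfer (rule lie_eq.scale_add)
    show "g_scale c (g_scale d x) = g_scale (c * d) x" by transfer (rule lie_eq.scale_scale)
    show "g_scale 1 x = x" by transfer (rule lie_eq.scale_one)
  qed
  interpret vector_space "g_scale :: complex \<Rightarrow> 's g_type \<Rightarrow> 's g_type" by (rule vs)
  note [simp] =
    g_bracket_plus_left g_bracket_plus_right g_bracket_scale_left g_bracket_scale_right
    g_bracket_self g_bracket_jacobi
  show ?thesis
    by (simp add: lie_algebra_def g_S_def vs)
qed

section \<open>The matrix algebra and its subspaces\<close>

text \<open>For finite \<open>S\<close>, the algebra with basis \<open>E\<close> is the full algebra of matrices
  indexed by the type \<open>'s\<close>, with product \<open>**\<close>.\<close>

type_synonym 's gl_type = "((complex, 's) vec, 's) vec"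

definition mat_scale :: "complex \<Rightarrow> 's::finite gl_type \<Rightarrow> 's gl_type" where
  "mat_scale c A = (\<chi> i j. c * A $ i $ j)"

definition E :: "'s::finite \<Rightarrow> 's \<Rightarrow> 's gl_type" where
  "E \<alpha> \<beta> = (\<chi> i j. if i = \<alpha> \<and> j = \<beta> then 1 else 0)"

lemma E_mult: "E \<alpha> \<beta> ** E \<mu> \<nu> = (if \<beta> = \<mu> then E \<alpha> \<nu> else 0)"
proof -
  have "(E \<alpha> \<beta> ** E \<mu> \<nu>) $ i $ j = (if \<beta> = \<mu> then E \<alpha> \<nu> else 0) $ i $ j" for i j
  proof -
    have "(E \<alpha> \<beta> ** E \<mu> \<nu>) $ i $ j =
        (\<Sum>k\<in>UNIV. if k = \<beta> then (if i = \<alpha> \<and> \<beta> = \<mu> \<and> j = \<nu> then 1 else 0) else 0)"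
      unfolding matrix_matrix_mult_def E_def vec_lambda_beta by (rule sum.cong) auto
    then show ?thesis by (simp add: E_def)
  qed
  then show ?thesis by (simp add: vec_eq_iff)
qed

definition gl_S :: "'s::finite gl_type lie_alg" where
  "gl_S = \<lparr>lie_carrier = UNIV, lie_scale = mat_scale, lie_bracket = (\<lambda>A B. A ** B - B ** A)\<rparr>"

text \<open>The linear extension of \<open>E \<alpha> \<beta> \<mapsto> - E \<beta> \<alpha>\<close>.\<close>

definition tau :: "'s::finite gl_type \<Rightarrow> 's gl_type" where
  "tau A = (\<Sum>\<alpha>\<in>UNIV. \<Sum>\<beta>\<in>UNIV. mat_scale (A $ \<alpha> $ \<beta>) (- E \<beta> \<alpha>))"

lemma tau_eq: "tau A = - transpose A"
proof -
  have "tau A $ i $ j = - transpose A $ i $ j" for i j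
  proof -
    have "tau A $ i $ j =
        (\<Sum>\<alpha>\<in>UNIV. \<Sum>\<beta>\<in>UNIV. if \<alpha> = j then (if \<beta> = i then - A $ j $ i else 0) else 0)"
      unfolding tau_def by (auto simp: mat_scale_def E_def intro!: sum.cong)
    also have "\<dots> = (\<Sum>\<alpha>\<in>UNIV. if \<alpha> = j then - A $ j $ i else 0)"
      by (rule sum.cong) auto
    finally show ?thesis by (simp add: transpose_def)
  qed
  then show ?thesis by (simp add: vec_eq_iff)
qed

lemma tau_E: "tau (E \<alpha> \<beta>) = - E \<beta> \<alpha>"
  by (auto simp: tau_eq E_def transpose_def vec_eq_iff)

definition gl_S_tau :: "'s::finite gl_type lie_alg" where
  "gl_S_tau = gl_S\<lparr>lie_carrier := {A. tau A = A}\<rparr>"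

definition A_S :: "'s::{finite, ab_group_add} gl_type set" where
  "A_S = module.span mat_scale {E (\<alpha> + \<beta>) (\<beta> - \<alpha>) | \<alpha> \<beta>. True}"

end

theory Submission
  imports Defs
begin

text \<open>The map \<open>d\<^bsup>\<alpha>,\<beta>\<^esup> \<mapsto> E\<^bsub>\<beta>-\<alpha>,\<alpha>+\<beta>\<^esub> - E\<^bsub>\<alpha>+\<beta>,\<beta>-\<alpha>\<^esub>\<close> respects the relations and is inverted
  using division by 2 in \<open>S\<close>. The orthogonal algebra so obtained is brought into split form by the
  symmetric square root \<open>((1 - \<i>) + (1 + \<i>) N) / 2\<close> of the permutation matrix \<open>N\<close> of \<open>a \<mapsto> - a\<close>.
  There the antidiagonal matrices form a Cartan subalgebra \<open>H\<close>, acting on the \<open>(a, b)\<close>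
  entry by the weight \<open>\<epsilon>\<^sub>a + \<epsilon>\<^sub>b\<close> with \<open>\<epsilon>\<^sub>a h = h\<^bsub>a,-a\<^esub>\<close>, and an enumeration of \<open>S - {0}\<close> up to sign gives the
  base \<open>\<epsilon>\<^sub>0 - \<epsilon>\<^sub>1, \<dots>, \<epsilon>\<^bsub>l-2\<^esub> - \<epsilon>\<^bsub>l-1\<^esub>, \<epsilon>\<^bsub>l-1\<^esub>\<close> of type \<open>B\<^sub>l\<close>.
  Simplicity is checked in the compact form, where the squares of the \<open>ad (E\<^bsub>a,b\<^esub> - E\<^bsub>b,a\<^esub>)\<close> are
  commuting coordinate projections up to sign.\<close>

section \<open>Skew-symmetric matrices\<close>

lemma mat_scale_nth [simp]: "mat_scale c A $ i $ j = c * A $ i $ j"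
  by (simp add: mat_scale_def)

lemma E_nth [simp]: "E a b $ i $ j = (if i = a \<and> j = b then 1 else 0)"
  by (simp add: E_def)

lemma transpose_nth: "transpose A $ i $ j = A $ j $ i"
  by (simp add: transpose_def)

lemma matrix_eqI: "(\<And>i j. A $ i $ j = B $ i $ j) \<Longrightarrow> A = B" for A :: "'a^'n^'m"
  by (simp add: vec_eq_iff)

lemma vector_space_mat_scale: "vector_space (mat_scale :: complex \<Rightarrow> 's::finite gl_type \<Rightarrow> 's gl_type)"
  by unfold_locales (auto intro!: matrix_eqI simp: algebra_simps)

interpretation gl: vector_space "mat_scale :: complex \<Rightarrow> 's::finite gl_type \<Rightarrow> 's gl_type"
  by (rule vector_space_mat_scale)

lemma transpose_linear:
  "transpose 0 = (0 :: 's::finite gl_type)"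
  "transpose (A + B) = transpose A + transpose B" "transpose (A - B) = transpose A - transpose B"
  "transpose (mat_scale c A) = mat_scale c (transpose A)" for A B :: "'s::finite gl_type"
  by (simp_all add: vec_eq_iff transpose_nth)

lemma matrix_add_rdistrib: "(A + B) ** C = A ** C + B ** C" for A B C :: "'s::finite gl_type"
  by (rule matrix_eqI) (simp add: matrix_matrix_mult_def algebra_simps sum.distrib)

lemma matrix_diff_ldistrib: "A ** (B - C) = A ** B - A ** C" for A B C :: "'s::finite gl_type"
  by (rule matrix_eqI) (simp add: matrix_matrix_mult_def algebra_simps sum_subtractf)

lemma matrix_diff_rdistrib: "(A - B) ** C = A ** C - B ** C" for A B C :: "'s::finite gl_type"
  by (rule matrix_eqI) (simp add: matrix_matrix_mult_def algebra_simps sum_subtractf)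

lemma matrix_minus_left: "(- A) ** B = - (A ** B)" for A B :: "'s::finite gl_type"
  by (rule matrix_eqI) (simp add: matrix_matrix_mult_def sum_negf)

lemma matrix_minus_right: "A ** (- B) = - (A ** B)" for A B :: "'s::finite gl_type"
  by (rule matrix_eqI) (simp add: matrix_matrix_mult_def sum_negf)

lemma mat_scale_mult_left: "mat_scale c A ** B = mat_scale c (A ** B)"
  by (rule matrix_eqI) (simp add: matrix_matrix_mult_def sum_distrib_left mult.assoc)

lemma mat_scale_mult_right: "A ** mat_scale c B = mat_scale c (A ** B)"
  by (rule matrix_eqI) (simp add: matrix_matrix_mult_def sum_distrib_left mult.left_commute)

lemmas matrix_ring_simps = matrix_add_ldistrib matrix_add_rdistrib matrix_diff_ldistrib
  matrix_diff_rdistrib matrix_minus_left matrix_minus_right mat_scale_mult_left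
  mat_scale_mult_right gl.scale_right_distrib gl.scale_right_diff_distrib

definition skew :: "'s::finite gl_type set" where
  "skew = {A. transpose A = - A}"

lemma skew_iff: "A \<in> skew \<longleftrightarrow> (\<forall>i j. A $ i $ j = - A $ j $ i)"
proof -
  have "A \<in> skew \<longleftrightarrow> (\<forall>i j. transpose A $ i $ j = (- A) $ i $ j)"
    unfolding skew_def by (simp only: mem_Collect_eq vec_eq_iff)
  also have "\<dots> \<longleftrightarrow> (\<forall>j i. A $ i $ j = - A $ j $ i)"
    by (simp only: transpose_nth vector_uminus_component)
  finally show ?thesis by blast
qed

lemma skew_nth: "A \<in> skew \<Longrightarrow> A $ i $ j = - A $ j $ i"
  unfolding skew_iff by blast

lemma skew_diag: "A \<in> skew \<Longrightarrow> A $ i $ i = 0"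
  using skew_nth[of A i i] by (simp only: eq_neg_iff_add_eq_0 flip: mult_2) simp

lemma subspace_skew: "gl.subspace skew"
  by (simp add: gl.subspace_def skew_def transpose_linear)

definition skew_unit :: "'s \<Rightarrow> 's \<Rightarrow> 's::finite gl_type" where
  "skew_unit a b = E a b - E b a"

lemma skew_unit_nth: "skew_unit a b $ i $ j =
    (if i = a \<and> j = b then 1 else 0) - (if i = b \<and> j = a then 1 else 0)"
  by (simp add: skew_unit_def)

lemma skew_unit_skew [simp]: "skew_unit a b \<in> skew"
  by (simp add: skew_def skew_unit_def transpose_linear) (simp add: vec_eq_iff transpose_nth conj_commute)

lemma skew_unit_swap: "skew_unit b a = - skew_unit a b"
  by (simp add: skew_unit_def)

lemma skew_unit_self [simp]: "skew_unit a a = 0"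
  by (simp add: skew_unit_def)

lemma matrix_expand: "A = (\<Sum>a\<in>UNIV. \<Sum>b\<in>UNIV. mat_scale (A $ a $ b) (E a b))"
proof (rule matrix_eqI)
  fix i j
  have "A $ a $ b * (if i = a \<and> j = b then 1 else 0)
      = (if b = j then if a = i then A $ a $ b else 0 else 0)" for a b
    by auto
  then have "(\<Sum>a\<in>UNIV. \<Sum>b\<in>UNIV. mat_scale (A $ a $ b) (E a b)) $ i $ j
      = (\<Sum>a\<in>UNIV. \<Sum>b\<in>UNIV. if b = j then if a = i then A $ a $ b else 0 else 0)"
    by simp
  also have "\<dots> = A $ i $ j"
    by simp
  finally show "A $ i $ j = (\<Sum>a\<in>UNIV. \<Sum>b\<in>UNIV. mat_scale (A $ a $ b) (E a b)) $ i $ j"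
    by (rule HOL.sym)
qed

text \<open>The factor 1/2 compensates for the double sum meeting each unordered pair of indices
  twice.\<close>

lemma skew_expand:
  assumes "A \<in> skew"
  shows "A = (\<Sum>a\<in>UNIV. \<Sum>b\<in>UNIV. mat_scale (A $ a $ b / 2) (skew_unit a b))"
proof (rule matrix_eqI)
  fix i j
  have "(\<Sum>a\<in>UNIV. \<Sum>b\<in>UNIV. mat_scale (A $ a $ b / 2) (skew_unit a b)) $ i $ j
      = (\<Sum>a\<in>UNIV. \<Sum>b\<in>UNIV. (if b = j then if a = i then A $ i $ j / 2 else 0 else 0)
          - (if b = i then if a = j then A $ j $ i / 2 else 0 else 0))"
    by (auto simp: skew_unit_nth intro!: sum.cong)
  also have "\<dots> = A $ i $ j / 2 - A $ j $ i / 2"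
    by (simp add: sum_subtractf)
  also have "\<dots> = A $ i $ j"
    using skew_nth[OF assms, of i j] by (simp add: field_simps)
  finally show "A $ i $ j = (\<Sum>a\<in>UNIV. \<Sum>b\<in>UNIV. mat_scale (A $ a $ b / 2) (skew_unit a b)) $ i $ j"
    by (rule HOL.sym)
qed

text \<open>If \<open>N\<close> is symmetric and invertible, this is the orthogonal Lie algebra of the form \<open>N\<close>,
  with the element \<open>A N\<close> of that algebra encoded by the skew-symmetric matrix \<open>A\<close>.\<close>

definition skew_alg :: "'s::finite gl_type \<Rightarrow> 's gl_type lie_alg" where
  "skew_alg N = \<lparr>lie_carrier = skew, lie_scale = mat_scale,
     lie_bracket = (\<lambda>A B. A ** N ** B - B ** N ** A)\<rparr>"

lemma skew_alg_simps [simp]: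
  "lie_carrier (skew_alg N) = skew" "lie_scale (skew_alg N) = mat_scale"
  "lie_bracket (skew_alg N) A B = A ** N ** B - B ** N ** A"
  by (simp_all add: skew_alg_def)

lemma gl_S_tau_eq: "gl_S_tau = skew_alg (mat 1)"
  by (auto simp: gl_S_tau_def gl_S_def skew_alg_def skew_def tau_eq minus_equation_iff)

text \<open>The bracket is the commutator of the associative product \<open>A ** N ** B\<close>,
  whence the Jacobi identity. For symmetric \<open>N\<close>, transposition reverses this product on
  skew matrices, whence closure.\<close>

lemma lie_algebra_skew_alg:
  assumes N: "transpose N = N"
  shows "lie_algebra (skew_alg N)"
proof -
  have "A ** N ** B - B ** N ** A \<in> skew" if "A \<in> skew" "B \<in> skew" for A B
  proof -
    have "transpose (A ** N ** B - B ** N ** A) = transpose (A ** N ** B) - transpose (B ** N ** A)"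
      by (rule transpose_linear)
    also have "\<dots> = - (A ** N ** B - B ** N ** A)"
      using that
      by (simp add: matrix_transpose_mul N skew_def matrix_ring_simps matrix_mul_assoc)
    finally show ?thesis by (simp add: skew_def)
  qed
  then show ?thesis
    unfolding lie_algebra_def skew_alg_simps
    by (simp add: vector_space_mat_scale subspace_skew matrix_ring_simps matrix_mul_assoc)
qed

section \<open>The algebra given by generators and relations\<close>

definition half :: "'s::{finite, ab_group_add} \<Rightarrow> 's" where
  "half x = (THE y. y + y = x)"

text \<open>Summing over all translates: \<open>CARD('s) \<cdot> x = 0\<close>.\<close>

lemma double_eq_0_imp:
  fixes x :: "'s::{finite, ab_group_add}"
  assumes odd_card: "odd CARD('s)" and x: "x + x = 0"
  shows "x = 0"
proof -
  have "(\<Sum>y\<in>A. x) = (if even (card A) then 0 else x)" if "finite A" for A :: "'s set"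
    using that by (induction A) (auto simp: x)
  then have 1: "(\<Sum>y\<in>(UNIV::'s set). x) = x"
    using odd_card by simp
  have "(\<Sum>y\<in>(UNIV::'s set). x + y) = (\<Sum>y\<in>UNIV. y)"
    by (rule sum.reindex_bij_witness[where i = "\<lambda>y. y - x" and j = "\<lambda>y. x + y"]) auto
  then show ?thesis
    using 1 by (simp add: sum.distrib)
qed

context
  assumes odd_card: "odd CARD('s::{finite, ab_group_add})"
begin

lemma double_eq_iff: "x + x = y + y \<longleftrightarrow> x = (y::'s)"
  using double_eq_0_imp[OF odd_card, of "x - y"] by (auto simp: algebra_simps)

lemma half_double: "half (x + x) = (x::'s)"
  unfolding half_def by (rule the_equality) (auto simp: double_eq_iff)

text \<open>Doubling is injective, hence onto because the group is finite.\<close>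

lemma double_half: "half x + half x = (x::'s)"
proof -
  have "surj (\<lambda>x::'s. x + x)"
    by (rule finite_UNIV_inj_surj) (auto simp: inj_def double_eq_iff)
  then obtain y where "x = y + y" unfolding surj_def by blast
  then show ?thesis by (simp add: half_double)
qed

end

lemma A_S_eq_UNIV:
  assumes "odd CARD('s::{finite, ab_group_add})"
  shows "(A_S :: 's gl_type set) = UNIV"
proof -
  have E_mem: "E a b \<in> {E (\<alpha> + \<beta>) (\<beta> - \<alpha>) | \<alpha> \<beta>. True}" for a b :: 's
  proof -
    \<comment> \<open>The parameters of \<open>E a b\<close> are \<alpha> = (a - b)/2 and \<beta> =
      (a + b)/2. Identities between halves are checked after doubling, which is injective.\<close>
    have "half (a + b) + half (a + b) = half (a - b) + half (a - b) + (b + b)"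
      by (simp add: double_half[OF assms])
    then have "half (a + b) + half (a + b) = (half (a - b) + b) + (half (a - b) + b)"
      by (simp add: algebra_simps)
    then have "half (a + b) = half (a - b) + b"
      by (simp add: double_eq_iff[OF assms])
    moreover have "half (a - b) + (half (a - b) + b) = a"
      using double_half[OF assms, of "a - b"] by (simp add: algebra_simps)
    ultimately have "E a b = E (half (a - b) + half (a + b)) (half (a + b) - half (a - b))"
      by simp
    then show ?thesis by blast
  qed
  have "A \<in> (A_S :: 's gl_type set)" for A
    unfolding A_S_def
    by (subst matrix_expand[of A], intro gl.span_sum gl.span_scale gl.span_base E_mem)
  then show ?thesis by blast
qed

section \<open>The matrix representation of the presented algebra\<close>

definition d_mat :: "'s::{finite, ab_group_add} \<Rightarrow> 's \<Rightarrow> 's gl_type" where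
  "d_mat \<alpha> \<beta> = skew_unit (\<beta> - \<alpha>) (\<alpha> + \<beta>)"

lemma d_mat_uminus: "d_mat (- \<alpha>) \<beta> = - d_mat \<alpha> \<beta>"
  by (simp add: d_mat_def skew_unit_def add.commute)

text \<open>Each delta records that an index of the first matrix meets one of the second: \<alpha> +
  \<mu> = \<nu> - \<beta>, say, means \<alpha> + \<beta> = \<nu> - \<mu>. The order of indices in
  \<open>d_mat\<close> matters, since negating every \<open>d_mat\<close> keeps the left side and
  negates the right one.\<close>

lemma d_mat_bracket:
  fixes \<alpha> \<beta> \<mu> \<nu> :: "'s::{finite, ab_group_add}"
  shows "d_mat \<alpha> \<beta> ** d_mat \<mu> \<nu> - d_mat \<mu> \<nu> ** d_mat \<alpha> \<beta> =
      (if \<alpha> + \<mu> = \<nu> - \<beta> then d_mat (\<alpha> + \<mu>) (- \<alpha> + \<nu>) else 0)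
    - (if \<alpha> + \<mu> = \<beta> - \<nu> then d_mat (\<alpha> + \<mu>) (\<alpha> + \<nu>) else 0)
    + (- (if \<alpha> - \<mu> = \<nu> - \<beta> then d_mat (\<alpha> - \<mu>) (\<nu> - \<alpha>) else 0)
    + (if \<alpha> - \<mu> = \<beta> - \<nu> then d_mat (\<alpha> - \<mu>) (\<alpha> + \<nu>) else 0))"
    (is "_ = ?t1 - ?t2 + (- ?t3 + ?t4)")
proof -
  \<comment> \<open>The four equations state each delta condition in both orientations, because
    \<open>E_mult\<close> produces one orientation from the product and the other from the reversed
    product.\<close>
  have 1: "?t1 = (if \<alpha> + \<beta> = \<nu> - \<mu> then E (\<beta> - \<alpha>) (\<mu> + \<nu>) else 0)
      - (if \<nu> - \<mu> = \<alpha> + \<beta> then E (\<mu> + \<nu>) (\<beta> - \<alpha>) else 0)"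
  proof (cases "\<nu> = \<alpha> + \<beta> + \<mu>")
    case True
    show ?thesis
      unfolding True by (simp add: d_mat_def skew_unit_def algebra_simps)
  qed (auto simp: algebra_simps)
  have 2: "?t2 = (if \<mu> + \<nu> = \<beta> - \<alpha> then E (\<nu> - \<mu>) (\<alpha> + \<beta>) else 0)
      - (if \<beta> - \<alpha> = \<mu> + \<nu> then E (\<alpha> + \<beta>) (\<nu> - \<mu>) else 0)"
  proof (cases "\<beta> = \<alpha> + \<mu> + \<nu>")
    case True
    show ?thesis
      unfolding True by (simp add: d_mat_def skew_unit_def algebra_simps)
  qed (auto simp: algebra_simps)
  have 3: "?t3 = (if \<alpha> + \<beta> = \<mu> + \<nu> then E (\<beta> - \<alpha>) (\<nu> - \<mu>) else 0)
      - (if \<mu> + \<nu> = \<alpha> + \<beta> then E (\<nu> - \<mu>) (\<beta> - \<alpha>) else 0)"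
  proof (cases "\<nu> = \<alpha> + \<beta> - \<mu>")
    case True
    show ?thesis
      unfolding True by (simp add: d_mat_def skew_unit_def algebra_simps)
  qed (auto simp: algebra_simps)
  have 4: "?t4 = (if \<nu> - \<mu> = \<beta> - \<alpha> then E (\<mu> + \<nu>) (\<alpha> + \<beta>) else 0)
      - (if \<beta> - \<alpha> = \<nu> - \<mu> then E (\<alpha> + \<beta>) (\<mu> + \<nu>) else 0)"
  proof (cases "\<nu> = \<beta> - \<alpha> + \<mu>")
    case True
    show ?thesis
      unfolding True by (simp add: d_mat_def skew_unit_def algebra_simps)
  qed (auto simp: algebra_simps)
  show ?thesis
    unfolding 1 2 3 4
    by (simp add: d_mat_def[of \<alpha> \<beta>] d_mat_def[of \<mu> \<nu>] skew_unit_def matrix_ring_simps E_mult)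
qed

primrec expr_mat :: "('s::{finite, ab_group_add} \<times> 's) lie_expr \<Rightarrow> 's gl_type" where
  "expr_mat (Gen p) = d_mat (fst p) (snd p)"
| "expr_mat Zero = 0"
| "expr_mat (Plus s t) = expr_mat s + expr_mat t"
| "expr_mat (Neg s) = - expr_mat s"
| "expr_mat (Scale c s) = mat_scale c (expr_mat s)"
| "expr_mat (Bracket s t) = expr_mat s ** expr_mat t - expr_mat t ** expr_mat s"

lemma expr_mat_delta: "expr_mat (delta_expr a b e) = (if a = b then expr_mat e else 0)"
  by (simp add: delta_expr_def)

text \<open>This is the universal property of the presentation: commutators obey the Lie axioms, so
  only the defining relations need a computation.\<close>

lemma expr_mat_cong:
  fixes s t :: "('s::{finite, ab_group_add} \<times> 's) lie_expr"
  assumes "lie_eq d_relations s t"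
  shows "expr_mat s = expr_mat t"
  using assms
proof (induction rule: lie_eq.induct)
  case (rel s t)
  then consider \<alpha> \<beta> where "s = d_expr (-\<alpha>) \<beta>" "t = Neg (d_expr \<alpha> \<beta>)"
    | \<alpha> \<beta> \<mu> \<nu> where "s = Bracket (d_expr \<alpha> \<beta>) (d_expr \<mu> \<nu>)"
      "t = Plus
        (Plus (delta_expr (\<alpha> + \<mu>) (\<nu> - \<beta>) (d_expr (\<alpha> + \<mu>) (-\<alpha> + \<nu>)))
              (Neg (delta_expr (\<alpha> + \<mu>) (\<beta> - \<nu>) (d_expr (\<alpha> + \<mu>) (\<alpha> + \<nu>)))))
        (Plus (Neg (delta_expr (\<alpha> - \<mu>) (\<nu> - \<beta>) (d_expr (\<alpha> - \<mu>) (\<nu> - \<alpha>))))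
              (delta_expr (\<alpha> - \<mu>) (\<beta> - \<nu>) (d_expr (\<alpha> - \<mu>) (\<alpha> + \<nu>))))"
    unfolding d_relations_def by blast
  then show ?case
  proof cases
    case 1
    then show ?thesis by (simp add: d_expr_def d_mat_uminus)
  next
    case 2
    then show ?thesis
      using d_mat_bracket[of \<alpha> \<beta> \<mu> \<nu>] by (simp add: d_expr_def expr_mat_delta)
  qed
qed (simp_all add: matrix_ring_simps matrix_mul_assoc gl.scale_left_distrib)

lemma expr_mat_skew: "expr_mat s \<in> skew"
proof (induction s)
  case (Bracket s t)
  have "lie_algebra (skew_alg (mat 1 :: 'a gl_type))"
    by (rule lie_algebra_skew_alg) simp
  with Bracket show ?case by (simp add: lie_algebra_def)
qed (simp_all add: d_mat_def gl.subspace_0[OF subspace_skew] gl.subspace_add[OF subspace_skew]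
  gl.subspace_neg[OF subspace_skew] gl.subspace_scale[OF subspace_skew])

section \<open>Linear generation of the presented algebra\<close>

interpretation gS: vector_space "g_scale :: complex \<Rightarrow> 's::ab_group_add g_type \<Rightarrow> 's g_type"
  using lie_algebra_g_S[where 's = 's] unfolding lie_algebra_def g_S_def by simp

lift_definition g_d :: "'s::ab_group_add \<Rightarrow> 's \<Rightarrow> 's g_type" is d_expr .

lemma g_d_uminus: "g_d (- \<alpha>) \<beta> = - g_d \<alpha> \<beta>"
  by transfer (rule lie_eq.rel, auto simp: d_relations_def)

text \<open>A lifted copy of \<open>delta_expr\<close> lets the defining relation be transferred
  verbatim; \<open>g_delta_eq\<close> then turns it into a conditional.\<close>

lift_definition g_delta :: "'s::ab_group_add \<Rightarrow> 's \<Rightarrow> 's g_type \<Rightarrow> 's g_type" is delta_expr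
  by (simp add: delta_expr_def lie_eq.refl)

lemma g_delta_eq: "g_delta a b x = (if a = b then x else 0)"
  unfolding zero_g_type_def
  by transfer (simp add: delta_expr_def lie_eq.refl)

lemma g_bracket_d:
  "g_bracket (g_d \<alpha> \<beta>) (g_d \<mu> \<nu>) =
     g_delta (\<alpha> + \<mu>) (\<nu> - \<beta>) (g_d (\<alpha> + \<mu>) (-\<alpha> + \<nu>))
     + - g_delta (\<alpha> + \<mu>) (\<beta> - \<nu>) (g_d (\<alpha> + \<mu>) (\<alpha> + \<nu>))
     + (- g_delta (\<alpha> - \<mu>) (\<nu> - \<beta>) (g_d (\<alpha> - \<mu>) (\<nu> - \<alpha>))
        + g_delta (\<alpha> - \<mu>) (\<beta> - \<nu>) (g_d (\<alpha> - \<mu>) (\<alpha> + \<nu>)))"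
  by transfer (rule lie_eq.rel, unfold d_relations_def, blast)

text \<open>The relations express the bracket of two generators linearly in generators. Their linear
  span is therefore closed under the bracket, and induction over formal expressions reaches every
  element. This bounds the presented algebra from above.\<close>

lemma g_span_d: "gS.span (range (\<lambda>(\<alpha>, \<beta>). g_d \<alpha> \<beta>)) = (UNIV :: 's::ab_group_add g_type set)"
proof -
  let ?V = "gS.span (range (\<lambda>(\<alpha>, \<beta>). g_d \<alpha> \<beta>)) :: 's g_type set"
  have d: "g_d \<alpha> \<beta> \<in> ?V" for \<alpha> \<beta>
    by (rule gS.span_base) auto
  have dd: "g_bracket (g_d \<alpha> \<beta>) (g_d \<mu> \<nu>) \<in> ?V" for \<alpha> \<beta> \<mu> \<nu>
    unfolding g_bracket_d g_delta_eq
    by (intro gS.span_add gS.span_neg; simp add: d gS.span_zero)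
  have bracket_0: "g_bracket x 0 = 0" "g_bracket 0 x = 0" for x :: "'s g_type"
    using g_bracket_plus_left[of 0 0 x] g_bracket_plus_right[of x 0 0] by simp_all
  have bracket: "g_bracket x y \<in> ?V" if x: "x \<in> ?V" and y: "y \<in> ?V" for x y
    using x
  proof (induction rule: gS.span_induct_alt)
    case base
    show ?case by (simp add: bracket_0 gS.span_zero)
  next
    case (step c u x)
    obtain \<alpha> \<beta> where u: "u = g_d \<alpha> \<beta>" using step by auto
    have "g_bracket u y \<in> ?V"
      using y
    proof (induction rule: gS.span_induct_alt)
      case base
      show ?case by (simp add: bracket_0 gS.span_zero)
    next
      case (step c v y)
      then show ?case
        by (auto simp: u g_bracket_plus_right g_bracket_scale_right intro!: gS.span_add gS.span_scale dd)
    qed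
    with step show ?case
      by (auto simp: g_bracket_plus_left g_bracket_scale_left intro!: gS.span_add gS.span_scale)
  qed
  have "x \<in> ?V" for x
  proof (induction x rule: g_type.abs_induct)
    case (1 t)
    then show ?case
    proof (induction t)
      case (Gen p)
      show ?case
        using d[of "fst p" "snd p"] by (simp add: g_d.abs_eq d_expr_def)
    qed (simp_all add: gS.span_zero gS.span_add gS.span_neg gS.span_scale bracket
      flip: zero_g_type.abs_eq plus_g_type.abs_eq uminus_g_type.abs_eq g_scale.abs_eq
        g_bracket.abs_eq zero_g_type_def)
  qed
  then show ?thesis by blast
qed

text \<open>The inverse sends \<open>skew_unit a b\<close> to \<open>d\<^bsup>\<alpha>,\<beta>\<^esup>\<close>
  with \<open>\<alpha> = (b - a) / 2\<close>, \<open>\<beta> = (a + b) / 2\<close>; it is a left inverse because the \<open>d\<^bsup>\<alpha>,\<beta>\<^esup>\<close> span.\<close>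

lemma g_S_iso_skew:
  assumes odd: "odd CARD('s::{finite, ab_group_add})"
  shows "lie_isomorphic (g_S :: 's g_type lie_alg) (skew_alg (mat 1) :: 's gl_type lie_alg)"
proof -
  \<comment> \<open>\<open>f\<close> evaluates a chosen representative; \<open>expr_mat_cong\<close>
    makes the choice immaterial.\<close>
  define f :: "'s g_type \<Rightarrow> 's gl_type" where "f = (\<lambda>x. expr_mat (rep_g_type x))"
  have f_abs: "f (abs_g_type t) = expr_mat t" for t
    unfolding f_def
    by (rule expr_mat_cong[OF rep_abs_rsp[OF Quotient3_g_type lie_eq.refl], symmetric])
  have f_add: "f (x + y) = f x + f y" for x y
    by (induction x; induction y) (simp add: plus_g_type.abs_eq f_abs)
  have f_scale: "f (g_scale c x) = mat_scale c (f x)" for c x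
    by (induction x) (simp add: g_scale.abs_eq f_abs)
  have f_bracket: "f (g_bracket x y) = f x ** f y - f y ** f x" for x y
    by (induction x; induction y) (simp add: g_bracket.abs_eq f_abs)
  have f_d: "f (g_d \<alpha> \<beta>) = d_mat \<alpha> \<beta>" for \<alpha> \<beta>
    by (simp add: g_d.abs_eq f_abs d_expr_def)
  have f_0: "f 0 = 0"
    using f_add[of 0 0] by simp
  have f_sum: "f (sum u I) = (\<Sum>i\<in>I. f (u i))" for u and I :: "'s set"
    by (induction I rule: infinite_finite_induct) (simp_all add: f_0 f_add)
  define D where "D = (\<lambda>a b :: 's. g_d (half (b - a)) (half (a + b)))"
  define g where "g = (\<lambda>A :: 's gl_type. \<Sum>a\<in>UNIV. \<Sum>b\<in>UNIV. g_scale (A $ a $ b / 2) (D a b))"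
  have half_minus: "half (- x) = - half x" for x :: 's
    using half_double[OF odd, of "- half x"] double_half[OF odd, of x]
    by (metis minus_add_distrib)
  have f_D: "f (D a b) = skew_unit a b" for a b
  proof -
    have "half (a + b) + half (a + b) = (half (b - a) + a) + (half (b - a) + a)"
      using double_half[OF odd, of "a + b"] double_half[OF odd, of "b - a"]
      by (metis (no_types, lifting) add.assoc add.commute diff_add_cancel)
    then have "half (a + b) = half (b - a) + a"
      by (simp add: double_eq_iff[OF odd])
    moreover have "half (b - a) + (half (b - a) + a) = b"
      using double_half[OF odd, of "b - a"] by (simp add: algebra_simps)
    ultimately show ?thesis
      by (simp add: D_def f_d d_mat_def)
  qed
  have fg: "f (g A) = A" if "A \<in> skew" for A
  proof -
    have "f (g A) = (\<Sum>a\<in>UNIV. \<Sum>b\<in>UNIV. mat_scale (A $ a $ b / 2) (skew_unit a b))"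
      by (simp add: g_def f_sum f_scale f_D)
    then show ?thesis using skew_expand[OF that] by simp
  qed
  have D_swap: "D b a = - D a b" for a b
    unfolding D_def by (metis add.commute minus_diff_eq half_minus g_d_uminus)
  have g_linear: "g (A + B) = g A + g B" "g (mat_scale c A) = g_scale c (g A)" for A B c
    by (simp_all add: g_def sum.distrib gS.scale_left_distrib add_divide_distrib gS.scale_sum_right)
  have g_d_mat: "g (d_mat \<alpha> \<beta>) = g_d \<alpha> \<beta>" for \<alpha> \<beta>
  proof -
    let ?a = "\<beta> - \<alpha>" and ?b = "\<alpha> + \<beta>"
    have D: "D ?a ?b = g_d \<alpha> \<beta>"
      using half_double[OF odd, of \<alpha>] half_double[OF odd, of \<beta>]
      by (simp add: D_def algebra_simps)
    \<comment> \<open>Only the entries at \<open>(?a, ?b)\<close> and \<open>(?b, ?a)\<close> can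
      contribute, each with weight 1/2; \<open>D_swap\<close> makes the two contributions
      agree.\<close>
    have "g (d_mat \<alpha> \<beta>) = (\<Sum>a\<in>UNIV. \<Sum>b\<in>UNIV.
        (if b = ?b then if a = ?a then g_scale (1/2) (D a b) else 0 else 0)
        - (if b = ?a then if a = ?b then g_scale (1/2) (D a b) else 0 else 0))"
      unfolding g_def d_mat_def skew_unit_nth
      by (auto intro!: sum.cong)
    also have "\<dots> = g_scale (1/2) (D ?a ?b) - g_scale (1/2) (D ?b ?a)"
      by (simp add: sum_subtractf)
    also have "\<dots> = g_scale (1/2) (D ?a ?b) + g_scale (1/2) (D ?a ?b)"
      unfolding D_swap[of ?b ?a] by simp
    also have "\<dots> = D ?a ?b"
      by (simp flip: gS.scale_left_distrib)
    finally show ?thesis unfolding D .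
  qed
  have gf: "g (f x) = x" for x
  proof -
    have "x \<in> gS.span (range (\<lambda>(\<alpha>, \<beta>). g_d \<alpha> \<beta>))"
      by (simp add: g_span_d)
    then show ?thesis
    proof (induction rule: gS.span_induct_alt)
      case base
      show ?case by (simp add: f_0 g_def)
    next
      case (step c u x)
      then show ?case by (auto simp: f_add f_scale g_linear f_d g_d_mat)
    qed
  qed
  have "f x \<in> skew" for x
    by (simp add: f_def expr_mat_skew)
  then have "bij_betw f UNIV skew"
    by (intro bij_betw_byWitness[where f' = g]) (auto simp: gf fg)
  then show ?thesis
    unfolding lie_isomorphic_def
    by (intro conjI lie_algebra_g_S lie_algebra_skew_alg exI[of _ f])
      (simp_all add: g_S_def f_add f_scale f_bracket)
qed

section \<open>Simplicity\<close>

lemma skew_unit_mult_nth: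
  "(skew_unit a b ** x) $ i $ j = (if i = a then x $ b $ j else 0) - (if i = b then x $ a $ j else 0)"
proof -
  have "skew_unit a b $ i $ k * x $ k $ j
      = (if k = b then if i = a then x $ b $ j else 0 else 0)
        - (if k = a then if i = b then x $ a $ j else 0 else 0)" for k
    by (auto simp: skew_unit_nth)
  then show ?thesis by (simp add: matrix_matrix_mult_def sum_subtractf)
qed

lemma mult_skew_unit_nth:
  "(x ** skew_unit a b) $ i $ j = (if j = b then x $ i $ a else 0) - (if j = a then x $ i $ b else 0)"
proof -
  have "x $ i $ k * skew_unit a b $ k $ j
      = (if k = a then if j = b then x $ i $ a else 0 else 0)
        - (if k = b then if j = a then x $ i $ b else 0 else 0)" for k
    by (auto simp: skew_unit_nth)
  then show ?thesis by (simp add: matrix_matrix_mult_def sum_subtractf)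
qed

definition sel :: "'s \<Rightarrow> 's \<Rightarrow> 's::finite gl_type \<Rightarrow> 's gl_type" where
  "sel a b x = (\<chi> i j. if (i \<in> {a, b}) \<noteq> (j \<in> {a, b}) then x $ i $ j else 0)"

lemma sel_nth: "sel a b x $ i $ j = (if (i \<in> {a, b}) \<noteq> (j \<in> {a, b}) then x $ i $ j else 0)"
  by (simp add: sel_def)

text \<open>On entries with exactly one index in {a, b} the bracket acts as a quarter turn between a
  and b, whose square is -1. Entries with no index there are killed at once, and the block on {a, b}
  is a multiple of \<open>skew_unit a b\<close>, which commutes with itself.\<close>

lemma ad_skew_unit_squared:
  assumes "x \<in> skew" "a \<noteq> b"
  shows "skew_unit a b ** (skew_unit a b ** x - x ** skew_unit a b)
    - (skew_unit a b ** x - x ** skew_unit a b) ** skew_unit a b = - sel a b x"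
proof (rule matrix_eqI)
  fix i j
  show "(skew_unit a b ** (skew_unit a b ** x - x ** skew_unit a b)
    - (skew_unit a b ** x - x ** skew_unit a b) ** skew_unit a b) $ i $ j = (- sel a b x) $ i $ j"
    using assms(2) skew_nth[OF assms(1), of b a] skew_diag[OF assms(1)]
    by (auto simp: skew_unit_mult_nth mult_skew_unit_nth sel_nth)
qed

lemma skew_unit_bracket:
  assumes "a \<noteq> b" "b \<noteq> c" "a \<noteq> c"
  shows "skew_unit a b ** skew_unit b c - skew_unit b c ** skew_unit a b = skew_unit a c"
  by (rule matrix_eqI, unfold vector_minus_component skew_unit_mult_nth mult_skew_unit_nth)
    (use assms in \<open>auto simp: skew_unit_nth\<close>)

lemma exists_outside:
  fixes A :: "'s::finite set"
  assumes "card A < CARD('s)"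
  shows "\<exists>a. a \<notin> A"
  using assms by (metis UNIV_I card_mono finite linorder_not_le subsetI)

text \<open>\<open>- ad (skew_unit a b)\<^sup>2\<close> is the projection \<open>sel a b\<close> onto the entries with
  exactly one index in \<open>{a, b}\<close>; composing such projections isolates a single entry.
  For \<open>n = 4\<close> this is impossible, in accordance with \<open>so\<^sub>4\<close> not being simple.\<close>

lemma skew_ideal_contains_unit:
  fixes x :: "'s::finite gl_type"
  assumes card: "CARD('s) \<ge> 3" "CARD('s) \<noteq> 4"
    and x: "x \<in> I" "x $ b $ c \<noteq> 0"
    and I: "gl.subspace I" "I \<subseteq> skew"
    and sel: "\<And>a b x. a \<noteq> b \<Longrightarrow> x \<in> I \<Longrightarrow> sel a b x \<in> I"
  shows "skew_unit b c \<in> I"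
proof -
  have x_skew: "x \<in> skew" using x I by auto
  have bc: "b \<noteq> c" using x(2) skew_diag[OF x_skew] by auto
  have isolated: "skew_unit b c \<in> I"
    if "y \<in> I" and y: "\<And>i j. y $ i $ j = (if {i, j} = {b, c} then x $ i $ j else 0)" for y
  proof -
    have "skew_unit b c = mat_scale (1 / x $ b $ c) y"
      using x(2) bc skew_nth[OF x_skew, of c b]
      by (intro matrix_eqI) (auto simp: y skew_unit_nth doubleton_eq_iff)
    then show ?thesis
      using gl.subspace_scale[OF I(1) that(1)] by simp
  qed
  have "card {b, c} < CARD('s)"
    using card bc by simp
  then obtain a where a: "a \<noteq> b" "a \<noteq> c"
    using exists_outside[of "{b, c}"] by auto
  show ?thesis
  proof (cases "CARD('s) = 3")
    case True
    then have "{a, b, c} = UNIV"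
      using a bc by (intro card_subset_eq) auto
    then have U: "i = a \<or> i = b \<or> i = c" for i by auto
    show ?thesis
    proof (rule isolated)
      show "sel a b (sel a c x) \<in> I"
        by (intro sel x a)
      show "sel a b (sel a c x) $ i $ j = (if {i, j} = {b, c} then x $ i $ j else 0)" for i j
        using U[of i] U[of j] a bc by (auto simp: sel_nth doubleton_eq_iff)
    qed
  next
    case False
    then have "card {a, b, c} < CARD('s)"
      using card a bc by simp
    then obtain d where d: "d \<noteq> a" "d \<noteq> b" "d \<noteq> c"
      using exists_outside[of "{a, b, c}"] by auto
    have "card {a, b, c, d} < CARD('s)"
      using card False a bc d by simp
    then obtain e where e: "e \<noteq> a" "e \<noteq> b" "e \<noteq> c" "e \<noteq> d"
      using exists_outside[of "{a, b, c, d}"] by auto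
    show ?thesis
    proof (rule isolated)
      \<comment> \<open>If a surviving entry involved \<open>a\<close>, its other index would be
        neither \<open>b\<close> nor \<open>c\<close>, and the selections with \<open>d\<close> and
        \<open>e\<close> would then require both of these. So \<open>a\<close> is absent, which
        forces \<open>b\<close> and \<open>c\<close>.\<close>
      show "sel a b (sel a c (sel b d (sel b e x))) \<in> I"
        using a d e by (intro sel x) auto
      show "sel a b (sel a c (sel b d (sel b e x))) $ i $ j
          = (if {i, j} = {b, c} then x $ i $ j else 0)" for i j
        using a bc d e by (auto simp: sel_nth doubleton_eq_iff)
    qed
  qed
qed

text \<open>A nonzero ideal contains one \<open>skew_unit\<close>; brackets with the others change
  its indices one at a time until all units, which span, are reached.\<close>

lemma lie_simple_skew:
  assumes card: "CARD('s::finite) \<ge> 3" "CARD('s) \<noteq> 4"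
  shows "lie_simple (skew_alg (mat 1) :: 's gl_type lie_alg)"
proof -
  obtain a b c :: 's where abc: "a \<noteq> b" "b \<noteq> c" "a \<noteq> c"
  proof -
    obtain a b where "a \<noteq> (b :: 's)"
      using exists_outside[of "{undefined :: 's}"] card by auto
    moreover obtain c where "c \<notin> {a, b}"
      using exists_outside[of "{a, b}"] card \<open>a \<noteq> b\<close> by auto
    ultimately show thesis using that by auto
  qed
  have "skew_unit a c \<noteq> 0"
    using abc(3) by (auto simp: vec_eq_iff skew_unit_nth)
  then have nonab: "\<exists>x\<in>skew. \<exists>y\<in>skew. x ** y - y ** x \<noteq> (0 :: 's gl_type)"
    using skew_unit_bracket[OF abc] skew_unit_skew by metis
  have "I = {0} \<or> I = skew" if "lie_ideal (skew_alg (mat 1 :: 's gl_type)) I" for I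
  proof (rule disjCI)
    have I: "I \<subseteq> skew" "gl.subspace I"
      and I_br: "\<And>x y. x \<in> skew \<Longrightarrow> y \<in> I \<Longrightarrow> x ** y - y ** x \<in> I"
      using that by (simp_all add: lie_ideal_def)
    have sel: "sel a b x \<in> I" if "a \<noteq> b" "x \<in> I" for a b x
      using I_br[OF skew_unit_skew I_br[OF skew_unit_skew that(2)], of a b a b]
        gl.subspace_neg[OF I(2)] ad_skew_unit_squared[OF _ that(1), of x] that(2) I(1)
      by fastforce
    have swap: "skew_unit b a \<in> I" if "skew_unit a b \<in> I" for a b
      using that gl.subspace_neg[OF I(2)] by (simp add: skew_unit_swap[of b a])
    have step: "skew_unit a c \<in> I" if "skew_unit b c \<in> I" "b \<noteq> c" "a \<noteq> c" for a b c
    proof (cases "a = b")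
      case False
      then show ?thesis
        using I_br[OF skew_unit_skew that(1), of a b] skew_unit_bracket[of a b c] that by simp
    qed (use that in simp)
    assume "I \<noteq> skew"
    show "I = {0}"
    proof (rule ccontr)
      assume "I \<noteq> {0}"
      then obtain x where "x \<in> I" "x \<noteq> 0"
        using gl.subspace_0[OF I(2)] by blast
      then obtain b c where "x $ b $ c \<noteq> 0"
        by (auto simp: vec_eq_iff)
      then have bc: "skew_unit b c \<in> I" "b \<noteq> c"
        using skew_ideal_contains_unit[OF card \<open>x \<in> I\<close> _ I(2,1) sel]
          skew_diag[of x b] \<open>x \<in> I\<close> I(1) by auto
      \<comment> \<open>First \<open>b\<close> is replaced by any index, then the unit is flipped
        and \<open>c\<close> is replaced.\<close>
      have unit: "skew_unit i j \<in> I" for i j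
      proof -
        have 1: "skew_unit k c \<in> I" if "k \<noteq> c" for k
          using step[OF bc that] .
        have 2: "skew_unit k i \<in> I" if "i \<noteq> k" "i \<noteq> c" for i k
          using swap[OF 1[OF that(2)]] step[of c i k] that by auto
        show ?thesis
          using 1 2[of j i] swap gl.subspace_0[OF I(2)]
          by (cases "i = j"; cases "j = c") auto
      qed
      have "x \<in> I" if "x \<in> skew" for x
        by (subst skew_expand[OF that])
          (intro gl.subspace_sum[OF I(2)] gl.subspace_scale[OF I(2)] unit)
      with I(1) \<open>I \<noteq> skew\<close> show False by blast
    qed
  qed
  then show ?thesis
    unfolding lie_simple_def
    using nonab lie_algebra_skew_alg[of "mat 1"] by simp
qed

section \<open>The split form\<close>

definition neg_mat :: "'s::{finite, ab_group_add} gl_type" where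
  "neg_mat = (\<chi> i j. if j = - i then 1 else 0)"

lemma transpose_neg_mat: "transpose neg_mat = neg_mat"
  by (rule matrix_eqI) (auto simp: transpose_nth neg_mat_def)

lemma mult_neg_mat_nth: "(A ** neg_mat) $ i $ j = A $ i $ (- j)"
proof -
  have "A $ i $ k * neg_mat $ k $ j = (if k = - j then A $ i $ k else 0)" for k
    by (auto simp: neg_mat_def)
  then show ?thesis by (simp add: matrix_matrix_mult_def)
qed

lemma neg_mat_neg_mat: "neg_mat ** neg_mat = mat 1"
  by (rule matrix_eqI) (simp add: mult_neg_mat_nth, simp add: neg_mat_def mat_def)

lemma mult_neg_mat_mult_nth: "(A ** neg_mat ** B) $ i $ j = (\<Sum>k\<in>UNIV. A $ i $ (- k) * B $ k $ j)"
proof -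
  have "(A ** neg_mat ** B) $ i $ j = (\<Sum>k\<in>UNIV. (A ** neg_mat) $ i $ k * B $ k $ j)"
    by (simp add: matrix_matrix_mult_def[of "A ** neg_mat"])
  then show ?thesis by (simp add: mult_neg_mat_nth)
qed

lemma neg_mat_sqrt:
  obtains P where "transpose P = P" "P ** P = neg_mat"
proof
  \<comment> \<open>As \<open>neg_mat\<close> squares to the identity, the square of \<alpha> +
    \<beta> N is (\<alpha>\<alpha> + \<beta>\<beta>) + 2\<alpha>\<beta> N; these values make the
    coefficients 0 and 1.\<close>
  define \<alpha> \<beta> where "\<alpha> = (1 - \<i>) / 2" and "\<beta> = (1 + \<i>) / 2"
  let ?P = "mat_scale \<alpha> (mat 1) + mat_scale \<beta> neg_mat"
  show "transpose ?P = ?P"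
    by (simp add: transpose_linear transpose_neg_mat)
  have 1: "\<alpha> * \<alpha> + \<beta> * \<beta> = 0" and 2: "\<alpha> * \<beta> + \<alpha> * \<beta> = 1"
    by (simp_all add: \<alpha>_def \<beta>_def field_simps)
  have "?P ** ?P = mat_scale (\<alpha> * \<alpha> + \<beta> * \<beta>) (mat 1) + mat_scale (\<alpha> * \<beta> + \<alpha> * \<beta>) neg_mat"
    by (simp add: matrix_ring_simps neg_mat_neg_mat) (simp add: vec_eq_iff algebra_simps)
  then show "?P ** ?P = neg_mat"
    by (simp add: 1 2)
qed

lemma skew_congruence:
  assumes "transpose Q = Q" "A \<in> skew"
  shows "Q ** A ** Q \<in> skew"
  using assms by (simp add: skew_def matrix_transpose_mul matrix_ring_simps matrix_mul_assoc)

text \<open>The change of form is a congruence: since \<open>Q ** neg_mat ** Q = mat 1\<close>,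
  sending A to QAQ carries the product of the identity form to that of
  \<open>neg_mat\<close>.\<close>

lemma skew_alg_iso_neg_mat:
  "lie_isomorphic (skew_alg (mat 1) :: 's::{finite, ab_group_add} gl_type lie_alg)
    (skew_alg neg_mat :: 's gl_type lie_alg)"
proof -
  obtain P :: "'s gl_type" where P: "transpose P = P" "P ** P = neg_mat"
    by (rule neg_mat_sqrt)
  \<comment> \<open>\<open>Q\<close> is the inverse of \<open>P\<close>, because
    \<open>P ** P = neg_mat\<close> is an involution.\<close>
  define Q where "Q = neg_mat ** P"
  have comm: "neg_mat ** P = P ** neg_mat"
    unfolding P(2)[symmetric] by (simp add: matrix_mul_assoc)
  have QT: "transpose Q = Q"
    unfolding Q_def by (simp add: matrix_transpose_mul transpose_neg_mat P comm)
  have QP: "Q ** P = mat 1" and PQ: "P ** Q = mat 1"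
    unfolding Q_def by (simp_all add: P neg_mat_neg_mat comm flip: matrix_mul_assoc,
        simp_all add: P neg_mat_neg_mat matrix_mul_assoc)
  have QQ: "Q ** neg_mat ** Q = mat 1"
    unfolding P(2)[symmetric] by (metis QP PQ matrix_mul_assoc matrix_mul_rid)
  define f where "f = (\<lambda>A. Q ** A ** Q)"
  have bij: "bij_betw f skew skew"
  proof (rule bij_betw_byWitness[where f' = "\<lambda>A. P ** A ** P"])
    show "\<forall>A\<in>skew. P ** f A ** P = A" "\<forall>A\<in>skew. f (P ** A ** P) = A"
      unfolding f_def by (metis QP PQ matrix_mul_assoc matrix_mul_lid matrix_mul_rid)+
    show "f ` skew \<subseteq> skew" "(\<lambda>A. P ** A ** P) ` skew \<subseteq> skew"
      unfolding f_def by (auto intro: skew_congruence QT P)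
  qed
  have "f A ** neg_mat ** f B = Q ** (A ** B) ** Q" for A B
  proof -
    have "f A ** neg_mat ** f B = Q ** A ** (Q ** neg_mat ** Q) ** (B ** Q)"
      by (simp add: f_def matrix_mul_assoc)
    then show ?thesis by (simp add: QQ matrix_mul_assoc)
  qed
  then have br: "f (A ** B - B ** A) = f A ** neg_mat ** f B - f B ** neg_mat ** f A" for A B
    by (simp add: f_def matrix_ring_simps)
  show ?thesis
    unfolding lie_isomorphic_def
    by (intro conjI lie_algebra_skew_alg exI[of _ f])
      (simp_all add: transpose_neg_mat bij br, simp_all add: f_def matrix_ring_simps)
qed

text \<open>Preimages of ideals under the isomorphism are ideals.\<close>

lemma lie_simple_iso:
  assumes iso: "lie_isomorphic L M" and L: "lie_simple L"
  shows "lie_simple M"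
proof -
  obtain f where LA: "lie_algebra L" and MA: "lie_algebra M"
    and bij: "bij_betw f (lie_carrier L) (lie_carrier M)"
    and add: "\<And>x y. x \<in> lie_carrier L \<Longrightarrow> y \<in> lie_carrier L \<Longrightarrow> f (x + y) = f x + f y"
    and scale: "\<And>c x. x \<in> lie_carrier L \<Longrightarrow> f (lie_scale L c x) = lie_scale M c (f x)"
    and br: "\<And>x y. x \<in> lie_carrier L \<Longrightarrow> y \<in> lie_carrier L \<Longrightarrow>
      f (lie_bracket L x y) = lie_bracket M (f x) (f y)"
    using iso unfolding lie_isomorphic_def by blast
  interpret L: vector_space "lie_scale L" using LA by (simp add: lie_algebra_def)
  interpret M: vector_space "lie_scale M" using MA by (simp add: lie_algebra_def)
  have sub: "L.subspace (lie_carrier L)" and br_L: "\<And>x y. x \<in> lie_carrier L \<Longrightarrow>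
      y \<in> lie_carrier L \<Longrightarrow> lie_bracket L x y \<in> lie_carrier L"
    using LA by (simp_all add: lie_algebra_def)
  have zero: "f 0 = 0"
    using add[of 0 0] L.subspace_0[OF sub] by simp
  have inj: "inj_on f (lie_carrier L)" and img: "f ` lie_carrier L = lie_carrier M"
    using bij by (auto simp: bij_betw_def)
  obtain x y where xy: "x \<in> lie_carrier L" "y \<in> lie_carrier L" "lie_bracket L x y \<noteq> 0"
    using L unfolding lie_simple_def by blast
  then have "lie_bracket M (f x) (f y) \<noteq> 0"
    using inj zero L.subspace_0[OF sub] br_L[OF xy(1,2)]
    by (metis br inj_onD)
  then have nonab: "\<exists>x\<in>lie_carrier M. \<exists>y\<in>lie_carrier M. lie_bracket M x y \<noteq> 0"
    using xy img by blast
  have "I = {0} \<or> I = lie_carrier M" if I: "lie_ideal M I" for I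
  proof -
    define J where "J = {x \<in> lie_carrier L. f x \<in> I}"
    have I_sub: "I \<subseteq> lie_carrier M" "M.subspace I"
      and I_br: "\<And>x y. x \<in> lie_carrier M \<Longrightarrow> y \<in> I \<Longrightarrow> lie_bracket M x y \<in> I"
      using I by (auto simp: lie_ideal_def)
    have fJ: "f ` J = I"
      using I_sub img by (auto simp: J_def)
    have "L.subspace J"
      using sub I_sub(2) by (auto simp: J_def L.subspace_def M.subspace_def add scale zero)
    moreover have "lie_bracket L x y \<in> J" if "x \<in> lie_carrier L" "y \<in> J" for x y
      using that img by (auto simp: J_def br br_L intro!: I_br)
    ultimately have "lie_ideal L J"
      by (auto simp: lie_ideal_def J_def)
    then have "J = {0} \<or> J = lie_carrier L"
      using L by (simp add: lie_simple_def)
    then show ?thesis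
      using fJ img zero by auto
  qed
  with MA nonab show ?thesis by (simp add: lie_simple_def)
qed

section \<open>Cartan subalgebra and roots for the split form\<close>

text \<open>As \<open>A\<close> encodes \<open>A ** neg_mat\<close>, antidiagonal matrices encode
  the diagonal elements of the orthogonal algebra, and \<open>weight a\<close> is the diagonal entry
  at \<open>a\<close>.\<close>

definition cartan_B :: "'s::{finite, ab_group_add} gl_type set" where
  "cartan_B = {A \<in> skew. \<forall>i j. j \<noteq> - i \<longrightarrow> A $ i $ j = 0}"

definition weight :: "'s \<Rightarrow> 's::{finite, ab_group_add} gl_type \<Rightarrow> complex" where
  "weight a h = h $ a $ (- a)"

lemma weight_add: "weight a (x + y) = weight a x + weight a y"
  by (simp add: weight_def)

lemma weight_scale: "weight a (mat_scale c x) = c * weight a x"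
  by (simp add: weight_def)

lemma weight_uminus: "h \<in> skew \<Longrightarrow> weight (- a) h = - weight a h"
  using skew_nth[of h "- a" a] by (simp add: weight_def)

lemma cartan_B_skew: "h \<in> cartan_B \<Longrightarrow> h \<in> skew"
  by (simp add: cartan_B_def)

lemma cartan_B_mult_nth:
  assumes h: "h \<in> cartan_B"
  shows "(h ** neg_mat ** x) $ i $ j = weight i h * x $ i $ j"
    and "(x ** neg_mat ** h) $ i $ j = - weight j h * x $ i $ j"
proof -
  have 1: "h $ i $ (- k) * x $ k $ j = (if k = i then weight i h * x $ k $ j else 0)" for k
    using h by (auto simp: cartan_B_def weight_def)
  show "(h ** neg_mat ** x) $ i $ j = weight i h * x $ i $ j"
    by (simp add: mult_neg_mat_mult_nth 1)
  have 2: "x $ i $ (- k) * h $ k $ j = (if k = - j then - weight j h * x $ i $ j else 0)" for k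
  proof (cases "k = - j")
    case True
    then show ?thesis
      using skew_nth[OF cartan_B_skew[OF h], of "- j" j] by (simp add: weight_def)
  next
    case False
    then have "j \<noteq> - k" by auto
    with False h show ?thesis by (simp add: cartan_B_def)
  qed
  show "(x ** neg_mat ** h) $ i $ j = - weight j h * x $ i $ j"
    by (simp add: mult_neg_mat_mult_nth 2)
qed

lemma cartan_B_bracket_nth:
  "h \<in> cartan_B \<Longrightarrow>
    (h ** neg_mat ** x - x ** neg_mat ** h) $ i $ j = (weight i h + weight j h) * x $ i $ j"
  by (simp add: cartan_B_mult_nth algebra_simps)

lemma subspace_cartan_B: "gl.subspace cartan_B"
  using subspace_skew by (auto simp: gl.subspace_def cartan_B_def)

definition cartan_elem :: "'s \<Rightarrow> 's::{finite, ab_group_add} gl_type" where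
  "cartan_elem a = skew_unit a (- a)"

lemma cartan_elem_mem [simp]: "cartan_elem a \<in> cartan_B"
  by (auto simp: cartan_B_def cartan_elem_def skew_unit_nth)

lemma weight_cartan_elem:
  "weight b (cartan_elem a) = (if b = a then 1 else 0) - (if b = - a then 1 else 0)"
  by (auto simp: weight_def cartan_elem_def skew_unit_nth)

lemma cartan_B_abelian:
  assumes "x \<in> cartan_B" "y \<in> cartan_B"
  shows "x ** neg_mat ** y - y ** neg_mat ** x = 0"
proof (rule matrix_eqI)
  fix i j
  show "(x ** neg_mat ** y - y ** neg_mat ** x) $ i $ j = 0 $ i $ j"
    unfolding cartan_B_bracket_nth[OF assms(1)]
    using assms weight_uminus[OF cartan_B_skew[OF assms(1)], of i]
    by (cases "j = - i") (auto simp: cartan_B_def)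
qed

lemma lie_product_cartan_B: "lie_product (skew_alg neg_mat) cartan_B cartan_B = {0}"
proof -
  have "{lie_bracket (skew_alg neg_mat) x y | x y. x \<in> cartan_B \<and> y \<in> cartan_B} = {0 :: 'a gl_type}"
    using cartan_B_abelian gl.subspace_0[OF subspace_cartan_B] by fastforce
  then show ?thesis
    by (simp add: lie_product_def gl.span_insert_0)
qed

text \<open>Odd order gives a \<noteq> -a for nonzero a, so the sum is 1 or 2 on
  \<open>cartan_elem a\<close>; if a = 0, \<open>cartan_elem b\<close> serves. Hence no position off
  the antidiagonal has weight zero.\<close>

lemma weight_sum_nonzero:
  fixes a b :: "'s::{finite, ab_group_add}"
  assumes odd: "odd CARD('s)" and "a \<noteq> - b"
  obtains h :: "'s gl_type" where "h \<in> cartan_B" "weight a h + weight b h \<noteq> 0"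
proof (cases "a = 0")
  case True
  with assms(2) have "b \<noteq> 0" by auto
  then have "b \<noteq> - b"
    using double_eq_0_imp[OF odd, of b] by (metis add.right_inverse)
  show ?thesis
    by (rule that[of "cartan_elem b"])
      (use True \<open>b \<noteq> 0\<close> \<open>b \<noteq> - b\<close> in \<open>auto simp: weight_cartan_elem\<close>)
next
  case False
  then have "a \<noteq> - a"
    using double_eq_0_imp[OF odd, of a] by (metis add.right_inverse)
  show ?thesis
    by (rule that[of "cartan_elem a"])
      (use False assms(2) \<open>a \<noteq> - a\<close> in \<open>auto simp: weight_cartan_elem\<close>)
qed

lemma cartan_subalgebra_B:
  assumes odd: "odd CARD('s::{finite, ab_group_add})"
  shows "cartan_subalgebra (skew_alg (neg_mat :: 's gl_type)) cartan_B"
proof -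
  let ?L = "skew_alg (neg_mat :: 's gl_type)"
  have "x \<in> cartan_B" if x: "x \<in> skew" and
    \<comment> \<open>Self-normalization: up to sign, the bracket with \<open>h\<close> multiplies
      the entry at (i, j) by a weight sum. Off the antidiagonal some \<open>h\<close> makes that
      factor nonzero, while the bracket vanishes there.\<close>
    norm: "\<And>h. h \<in> cartan_B \<Longrightarrow> lie_bracket ?L x h \<in> cartan_B" for x
  proof -
    have "x $ i $ j = 0" if ij: "j \<noteq> - i" for i j
    proof -
      obtain h :: "'s gl_type" where h: "h \<in> cartan_B" "weight i h + weight j h \<noteq> 0"
        using ij by (metis weight_sum_nonzero[OF odd] minus_minus)
      have "(h ** neg_mat ** x - x ** neg_mat ** h) $ i $ j
          = - lie_bracket ?L x h $ i $ j"
        by simp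
      also have "\<dots> = 0"
        using norm[OF h(1)] ij by (simp add: cartan_B_def)
      finally show ?thesis
        using h(2) by (simp only: cartan_B_bracket_nth[OF h(1)] mult_eq_0_iff) simp
    qed
    with x show ?thesis by (simp add: cartan_B_def)
  qed
  moreover have "lie_bracket ?L x y \<in> cartan_B" if "x \<in> cartan_B" "y \<in> cartan_B" for x y
    using cartan_B_abelian[OF that] gl.subspace_0[OF subspace_cartan_B] by simp
  moreover have "lower_central ?L cartan_B (Suc 0) = {0}"
    by (simp add: lie_product_cartan_B)
  ultimately show ?thesis
    unfolding cartan_subalgebra_def skew_alg_simps(1,2)
    using subspace_cartan_B cartan_B_skew by blast
qed

text \<open>The Cartan subalgebra acts entrywise, so one nonzero entry of a root vector determines
  the root.\<close>

lemma is_root_B_weights: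
  fixes \<beta> :: "'s::{finite, ab_group_add} gl_type \<Rightarrow> complex"
  assumes "is_root (skew_alg neg_mat) cartan_B \<beta>"
  obtains a b where "\<And>h. h \<in> cartan_B \<Longrightarrow> \<beta> h = weight a h + weight b h"
proof -
  let ?V = "root_space (skew_alg neg_mat) cartan_B \<beta>"
  have "0 \<in> ?V"
    by (simp add: root_space_def gl.subspace_0[OF subspace_skew] matrix_matrix_mult_def
        zero_vec_def[symmetric])
  then obtain x where x: "x \<in> ?V" "x \<noteq> 0"
    using assms unfolding is_root_def by blast
  then obtain a b where ab: "x $ a $ b \<noteq> 0"
    by (auto simp: vec_eq_iff)
  have "\<beta> h = weight a h + weight b h" if h: "h \<in> cartan_B" for h
  proof -
    have "(weight a h + weight b h) * x $ a $ b = \<beta> h * x $ a $ b"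
      using x(1) h by (simp add: root_space_def flip: cartan_B_bracket_nth)
    then show ?thesis using ab by simp
  qed
  then show thesis by (rule that)
qed

lemma skew_unit_root_space:
  assumes "\<And>h. h \<in> cartan_B \<Longrightarrow> \<beta> h = weight a h + weight b h"
  shows "skew_unit a b \<in> root_space (skew_alg neg_mat) cartan_B \<beta>"
proof -
  have "h ** neg_mat ** skew_unit a b - skew_unit a b ** neg_mat ** h
      = mat_scale (\<beta> h) (skew_unit a b)" if h: "h \<in> cartan_B" for h
    by (rule matrix_eqI, unfold cartan_B_bracket_nth[OF h])
      (use assms[OF h] in \<open>auto simp: skew_unit_nth\<close>)
  then show ?thesis by (simp add: root_space_def)
qed

lemma E_neg_mat_E: "E a b ** neg_mat ** E c d = (if c = - b then E a d else 0)"
proof (rule matrix_eqI)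
  fix i j
  have "E a b $ i $ (- k) * E c d $ k $ j
      = (if k = - b then (if c = - b then E a d else 0) $ i $ j else 0)" for k
    by auto
  then show "(E a b ** neg_mat ** E c d) $ i $ j = (if c = - b then E a d else 0) $ i $ j"
    unfolding mult_neg_mat_mult_nth by simp
qed

text \<open>The two units are root vectors of opposite weights; this bracket yields the simple
  coroots.\<close>

lemma skew_unit_bracket_opposite:
  assumes "a \<noteq> b" "a \<noteq> - b" "a \<noteq> - a \<or> b \<noteq> - b"
  shows "skew_unit a b ** neg_mat ** skew_unit (- b) (- a)
    - skew_unit (- b) (- a) ** neg_mat ** skew_unit a b = cartan_elem a + cartan_elem b"
  using assms
  by (auto simp: skew_unit_def cartan_elem_def matrix_ring_simps E_neg_mat_E)

text \<open>Representatives of S modulo sign, with the only self-opposite element 0 at the end,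
  where its zero weight closes the chain of simple roots.\<close>

locale half_system =
  fixes s :: "nat \<Rightarrow> 's::{finite, ab_group_add}" and l :: nat
  assumes s_l: "s l = 0"
    and s_inj: "inj_on s {..l}"
    and s_neg: "\<And>i j. i \<le> l \<Longrightarrow> j \<le> l \<Longrightarrow> s i = - s j \<Longrightarrow> i = l"
    and s_cover: "\<And>a. \<exists>i\<le>l. a = s i \<or> a = - s i"

lemma exists_half_system:
  assumes card: "CARD('s::{finite, ab_group_add}) = 2 * l + 1"
  shows "\<exists>s :: nat \<Rightarrow> 's. half_system s l"
proof -
  have odd: "odd CARD('s)" using card by simp
  \<comment> \<open>The injection into the naturals serves to choose one element of each pair {a,
    -a}.\<close>
  obtain f :: "'s \<Rightarrow> nat" where f: "inj f"
    using finite_imp_inj_to_nat_seg[of "UNIV :: 's set"] by auto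
  define P where "P = {a :: 's. f a < f (- a)}"
  have f_neg: "f a \<noteq> f (- a)" if "a \<noteq> 0" for a
    using f double_eq_0_imp[OF odd, of a] that by (metis add.right_inverse injD)
  have disj: "P \<inter> uminus ` P = {}"
    by (auto simp: P_def)
  have U: "UNIV = insert 0 (P \<union> uminus ` P)"
  proof -
    have "a \<in> insert 0 (P \<union> uminus ` P)" for a
      using f_neg[of a] by (cases "a = 0"; cases "f a < f (- a)")
        (auto simp: P_def intro: image_eqI[of _ _ "- a"])
    then show ?thesis by blast
  qed
  have "0 \<notin> P \<union> uminus ` P"
    by (auto simp: P_def)
  then have "CARD('s) = Suc (card (P \<union> uminus ` P))"
    by (subst U) simp
  also have "card (P \<union> uminus ` P) = card P + card P"
    using disj by (simp add: card_Un_disjoint card_image)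
  finally have "card P = l" using card by simp
  then obtain g where g: "bij_betw g {0..<l} P"
    using ex_bij_betw_nat_finite[of P] by auto
  define s where "s = (\<lambda>i. if i < l then g i else 0)"
  have s_P: "s i \<in> P" if "i < l" for i
    using g that by (auto simp: s_def bij_betw_def)
  have "inj_on s {..l}"
  proof (rule inj_onI)
    fix i j assume ij: "i \<in> {..l}" "j \<in> {..l}" "s i = s j"
    have "s i \<in> P \<longleftrightarrow> i < l" "s j \<in> P \<longleftrightarrow> j < l"
      using s_P \<open>0 \<notin> P \<union> uminus ` P\<close> by (auto simp: s_def)
    then show "i = j"
      using ij g by (auto simp: s_def bij_betw_def inj_on_def split: if_splits)
  qed
  moreover have "i = l" if "i \<le> l" "j \<le> l" "s i = - s j" for i j
  proof (rule ccontr)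
    assume "i \<noteq> l"
    with that(1) have "s i \<in> P" by (intro s_P) simp
    moreover from this have "j < l"
      using that \<open>0 \<notin> P \<union> uminus ` P\<close> by (cases "j = l") (auto simp: s_def)
    ultimately show False
      using s_P[of j] that(3) disj by auto
  qed
  moreover have "\<exists>i\<le>l. a = s i \<or> a = - s i" for a
  proof -
    have img: "\<exists>i<l. b = s i" if "b \<in> P" for b
      using g that by (force simp: s_def bij_betw_def)
    have "a \<in> insert 0 (P \<union> uminus ` P)" using U by blast
    then show ?thesis
    proof (elim insertE UnE imageE)
      assume "a = 0"
      then show ?thesis by (intro exI[of _ l]) (simp add: s_def)
    qed (use img less_imp_le in metis)+
  qed
  ultimately have "half_system s l"
    by unfold_locales (auto simp: s_def)
  then show ?thesis by blast
qed

lemma cartan_elem_0 [simp]: "cartan_elem 0 = 0"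
  by (simp add: cartan_elem_def)

lemma cartan_elem_uminus: "cartan_elem (- a) = - cartan_elem a"
  by (simp add: cartan_elem_def skew_unit_def)

section \<open>The base of simple roots and its coroots\<close>

context half_system
begin

lemma s_eq_iff: "i \<le> l \<Longrightarrow> j \<le> l \<Longrightarrow> s i = s j \<longleftrightarrow> i = j"
  using s_inj by (auto simp: inj_on_def)

lemma s_neq_neg: "i \<le> l \<Longrightarrow> j < l \<Longrightarrow> s i \<noteq> - s j" "i \<le> l \<Longrightarrow> j < l \<Longrightarrow> - s j \<noteq> s i"
  using s_neg[of j i] by (auto simp: minus_equation_iff)

lemma weight_s: "i \<le> l \<Longrightarrow> j < l \<Longrightarrow> weight (s i) (cartan_elem (s j)) = (if i = j then 1 else 0)"
  by (simp add: weight_cartan_elem s_eq_iff s_neq_neg)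

text \<open>\<open>s l = 0\<close> has weight \<open>0\<close>, so this covers the short root \<open>weight (s (l - 1))\<close>.\<close>

definition simple_root :: "nat \<Rightarrow> 's gl_type \<Rightarrow> complex" where
  "simple_root i h = weight (s i) h - weight (s (Suc i)) h"

text \<open>At the last index the second Cartan element is 0 and the short root is 1 on the first;
  the factor 2 normalizes this value to 2.\<close>

definition simple_coroot :: "nat \<Rightarrow> 's gl_type" where
  "simple_coroot i = mat_scale (if Suc i = l then 2 else 1) (cartan_elem (s i) - cartan_elem (s (Suc i)))"

lemma simple_coroot_mem: "simple_coroot i \<in> cartan_B"
  by (simp add: simple_coroot_def gl.subspace_scale gl.subspace_diff subspace_cartan_B)

lemma weight_diff: "weight a (x - y) = weight a x - weight a y"
  by (simp add: weight_def)

lemma weight_s_last: "h \<in> cartan_B \<Longrightarrow> weight (s l) h = 0"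
  by (simp add: s_l weight_def skew_diag cartan_B_skew)

lemma weight_s_le: "i \<le> l \<Longrightarrow> j \<le> l \<Longrightarrow>
    weight (s i) (cartan_elem (s j)) = (if i = j \<and> i < l then 1 else 0)"
  by (cases "j = l") (auto simp: weight_s s_l weight_def[of _ 0])

lemma simple_root_coroot:
  "i < l \<Longrightarrow> j < l \<Longrightarrow> simple_root i (simple_coroot j) = of_int (cartan_matrix_B l i j)"
  by (auto simp: simple_root_def simple_coroot_def weight_scale weight_diff weight_s_le
      cartan_matrix_B_def)

lemma simple_root_vector:
  assumes "i < l"
  shows "skew_unit (s i) (- s (Suc i)) \<in> root_space (skew_alg neg_mat) cartan_B (simple_root i)"
    and "skew_unit (s (Suc i)) (- s i) \<in> root_space (skew_alg neg_mat) cartan_B (\<lambda>h. - simple_root i h)"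
  by (rule skew_unit_root_space; simp add: simple_root_def weight_uminus cartan_B_skew)+

lemma is_coroot_simple:
  assumes i: "i < l"
  shows "is_coroot (skew_alg neg_mat) cartan_B (simple_root i) (simple_coroot i)"
proof -
  let ?e = "skew_unit (s i) (- s (Suc i))" and ?f = "skew_unit (s (Suc i)) (- s i)"
  have "?e ** neg_mat ** ?f - ?f ** neg_mat ** ?e = cartan_elem (s i) + cartan_elem (- s (Suc i))"
    using i s_neq_neg(1)[of "Suc i" i] s_neg[of i "Suc i"]
      skew_unit_bracket_opposite[of "s i" "- s (Suc i)"]
    by (auto simp: s_eq_iff s_neq_neg)
  also have "\<dots> = cartan_elem (s i) - cartan_elem (s (Suc i))"
    by (simp add: cartan_elem_uminus)
  finally have "cartan_elem (s i) - cartan_elem (s (Suc i)) \<in> lie_product (skew_alg neg_mat)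
      (root_space (skew_alg neg_mat) cartan_B (simple_root i))
      (root_space (skew_alg neg_mat) cartan_B (\<lambda>h. - simple_root i h))"
    unfolding lie_product_def skew_alg_simps
    by (intro gl.span_base CollectI exI[of _ ?e] exI[of _ ?f] conjI simple_root_vector[OF i]) simp
  then have "simple_coroot i \<in> lie_product (skew_alg neg_mat)
      (root_space (skew_alg neg_mat) cartan_B (simple_root i))
      (root_space (skew_alg neg_mat) cartan_B (\<lambda>h. - simple_root i h))"
    unfolding simple_coroot_def lie_product_def skew_alg_simps by (rule gl.span_scale)
  then show ?thesis
    using simple_root_coroot[OF i i] simple_coroot_mem
    by (simp add: is_coroot_def cartan_matrix_B_def)
qed

lemma is_root_simple:
  assumes i: "i < l"
  shows "is_root (skew_alg neg_mat) cartan_B (simple_root i)"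
proof -
  have "s i \<noteq> - s (Suc i)"
    using s_neg[of i "Suc i"] i by auto
  then have "skew_unit (s i) (- s (Suc i)) $ s i $ (- s (Suc i)) \<noteq> 0"
    by (simp add: skew_unit_nth)
  then have "skew_unit (s i) (- s (Suc i)) \<noteq> 0"
    by (metis zero_index)
  then have "root_space (skew_alg neg_mat) cartan_B (simple_root i) \<noteq> {0}"
    using simple_root_vector(1)[OF i] by blast
  moreover have "\<exists>h\<in>cartan_B. simple_root i h \<noteq> 0"
    using simple_root_coroot[OF i i] simple_coroot_mem 
    by (intro bexI[of _ "simple_coroot i"]) (simp_all add: cartan_matrix_B_def)
  ultimately show ?thesis
    by (simp add: is_root_def simple_root_def weight_add weight_scale algebra_simps)
qed

lemma simple_roots_independent:
  assumes c: "\<forall>h\<in>cartan_B. (\<Sum>i<l. c i * simple_root i h) = 0" and j: "j < l"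
  shows "c j = 0"
proof -
  \<comment> \<open>\<open>?w\<close> is the fundamental coweight at \<open>j\<close>: its weights
    are 1 up to index \<open>j\<close> and 0 afterwards, so only the difference at \<open>j\<close>
    is nonzero.\<close>
  let ?w = "\<Sum>k\<le>j. cartan_elem (s k)"
  have weight_sum: "weight a (sum u A) = (\<Sum>k\<in>A. weight a (u k))" for a u and A :: "nat set"
    by (induction A rule: infinite_finite_induct) (simp_all add: weight_def)
  have "weight (s i) ?w = (if i \<le> j then 1 else 0)" if "i \<le> l" for i
  proof -
    have "weight (s i) ?w = (\<Sum>k\<le>j. if i = k then 1 else 0)"
      unfolding weight_sum using that j by (intro sum.cong) (auto simp: weight_s)
    then show ?thesis by simp
  qed
  then have "simple_root i ?w = (if i = j then 1 else 0)" if "i < l" for i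
    using that by (auto simp: simple_root_def)
  then have "(\<Sum>i<l. c i * simple_root i ?w) = (\<Sum>i<l. if i = j then c i else 0)"
    by (intro sum.cong) auto
  moreover have "?w \<in> cartan_B"
    by (intro gl.subspace_sum subspace_cartan_B cartan_elem_mem)
  ultimately show ?thesis
    using c j by simp
qed

text \<open>The sum of the simple roots from \<open>i\<close> on telescopes, ending at the zero
  weight of \<open>s l\<close>.\<close>

lemma weight_s_telescope:
  assumes "i \<le> l" "h \<in> cartan_B"
  shows "weight (s i) h = (\<Sum>m<l. of_int (if i \<le> m then 1 else 0) * simple_root m h)"
proof -
  have "(\<Sum>m<l. of_int (if i \<le> m then 1 else 0) * simple_root m h) = (\<Sum>m=i..<l. simple_root m h)"
    by (rule sum.mono_neutral_cong_right) auto
  also have "\<dots> = - (\<Sum>m=i..<l. weight (s (Suc m)) h - weight (s m) h)"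
    by (simp add: simple_root_def flip: sum_negf)
  also have "\<dots> = weight (s i) h - weight (s l) h"
    using sum_Suc_diff'[OF assms(1), of "\<lambda>m. weight (s m) h"] by simp
  finally show ?thesis using assms(2) by (simp add: weight_s_last)
qed

lemma weight_combination:
  obtains \<sigma> :: int and i :: nat where "\<sigma> = 1 \<or> \<sigma> = - 1"
    "\<forall>h\<in>cartan_B.
      weight a h = (\<Sum>m<l. of_int (\<sigma> * (if i \<le> m then 1 else 0)) * simple_root m h)"
proof -
  obtain i where i: "i \<le> l" "a = s i \<or> a = - s i"
    using s_cover by blast
  then show thesis
  proof (elim disjE)
    assume "a = s i"
    then show thesis
      using i by (intro that[of 1 i]) (simp_all add: weight_s_telescope[of i])
  next
    assume "a = - s i"
    then show thesis
      using i
      by (intro that[of "- 1" i])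
        (simp_all add: weight_uminus cartan_B_skew weight_s_telescope[of i] flip: sum_negf)
  qed
qed

text \<open>Up to sign, the coefficients of each weight are the indicator of a final segment of
  indices. Of two such segments one contains the other, so even with opposite signs the combined
  coefficients never have mixed signs.\<close>

lemma weight_pair_combination:
  "\<exists>k :: nat \<Rightarrow> nat.
    (\<forall>h\<in>cartan_B. weight a h + weight b h = (\<Sum>m<l. of_nat (k m) * simple_root m h)) \<or>
    (\<forall>h\<in>cartan_B. weight a h + weight b h = - (\<Sum>m<l. of_nat (k m) * simple_root m h))"
proof -
  obtain \<sigma> i where \<sigma>: "\<sigma> = 1 \<or> \<sigma> = - 1" and a: "\<forall>h\<in>cartan_B.
      weight a h = (\<Sum>m<l. of_int (\<sigma> * (if i \<le> m then 1 else 0)) * simple_root m h)"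
    by (rule weight_combination[of a])
  obtain \<tau> j where \<tau>: "\<tau> = 1 \<or> \<tau> = - 1" and b: "\<forall>h\<in>cartan_B.
      weight b h = (\<Sum>m<l. of_int (\<tau> * (if j \<le> m then 1 else 0)) * simple_root m h)"
    by (rule weight_combination[of b])
  define c where "c = (\<lambda>m. \<sigma> * (if i \<le> m then 1 else 0) + \<tau> * (if j \<le> m then 1 else 0))"
  have ab: "weight a h + weight b h = (\<Sum>m<l. of_int (c m) * simple_root m h)"
    if "h \<in> cartan_B" for h
    by (simp only: a[rule_format, OF that] b[rule_format, OF that] c_def of_int_add distrib_right sum.distrib)
  have "(\<forall>m. c m \<ge> 0) \<or> (\<forall>m. c m \<le> 0)"
    using \<sigma> \<tau> by (cases "i \<le> j") (auto simp: c_def)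
  then show ?thesis
  proof (elim disjE)
    assume "\<forall>m. c m \<ge> 0"
    then show ?thesis
      by (intro exI[of _ "\<lambda>m. nat (c m)"] disjI1) (simp add: ab)
  next
    assume "\<forall>m. c m \<le> 0"
    then show ?thesis
      by (intro exI[of _ "\<lambda>m. nat (- c m)"] disjI2) (simp add: ab sum_negf)
  qed
qed

lemma root_base_B: "root_base (skew_alg neg_mat) cartan_B l simple_root"
  unfolding root_base_def
proof (intro conjI allI impI)
  fix \<beta> :: "'s gl_type \<Rightarrow> complex"
  assume "is_root (skew_alg neg_mat) cartan_B \<beta>"
  then obtain a b where "\<And>h. h \<in> cartan_B \<Longrightarrow> \<beta> h = weight a h + weight b h"
    using is_root_B_weights by blast
  then show "\<exists>k :: nat \<Rightarrow> nat.
      (\<forall>h\<in>cartan_B. \<beta> h = (\<Sum>i<l. of_nat (k i) * simple_root i h)) \<or>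
      (\<forall>h\<in>cartan_B. \<beta> h = - (\<Sum>i<l. of_nat (k i) * simple_root i h))"
    using weight_pair_combination[of a b] by simp
qed (use is_root_simple simple_roots_independent in blast)+

end

lemma lie_finite_dimensional_skew_alg: "lie_finite_dimensional (skew_alg N)"
proof -
  let ?B = "range (\<lambda>(a, b). skew_unit a b) :: 'a gl_type set"
  have "gl.span ?B \<subseteq> skew"
    by (rule gl.span_minimal[OF _ subspace_skew]) auto
  moreover have "x \<in> gl.span ?B" if "x \<in> skew" for x
    by (subst skew_expand[OF that], intro gl.span_sum gl.span_scale gl.span_base) auto
  ultimately show ?thesis
    unfolding lie_finite_dimensional_def skew_alg_simps by (intro exI[of _ ?B]) auto
qed

theorem corollary3p6:
  fixes l :: nat
  assumes "l > 0"
    and "CARD('s::{finite, ab_group_add}) = 2 * l + 1"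
  shows "(A_S :: 's gl_type set) = lie_carrier gl_S \<and>
    lie_isomorphic (g_S :: 's g_type lie_alg) (gl_S_tau :: 's gl_type lie_alg) \<and>
    (\<exists>B :: 's gl_type lie_alg.
       simple_of_type_B l B \<and> lie_isomorphic (gl_S_tau :: 's gl_type lie_alg) B)"
proof (intro conjI exI)
  have odd: "odd CARD('s)"
    using assms(2) by simp
  show "(A_S :: 's gl_type set) = lie_carrier gl_S"
    by (simp add: A_S_eq_UNIV[OF odd] gl_S_def)
  show "lie_isomorphic (g_S :: 's g_type lie_alg) (gl_S_tau :: 's gl_type lie_alg)"
    unfolding gl_S_tau_eq by (rule g_S_iso_skew[OF odd])
  show "lie_isomorphic (gl_S_tau :: 's gl_type lie_alg)
      (skew_alg neg_mat :: 's gl_type lie_alg)"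
    unfolding gl_S_tau_eq by (rule skew_alg_iso_neg_mat)
  \<comment> \<open>Odd order excludes 4, the case in which the simplicity argument fails.\<close>
  have "CARD('s) \<ge> 3" "CARD('s) \<noteq> 4"
    using assms by presburger+
  then have simple: "lie_simple (skew_alg (neg_mat :: 's gl_type))"
    using lie_simple_iso[OF skew_alg_iso_neg_mat lie_simple_skew] by blast
  obtain s :: "nat \<Rightarrow> 's" where "half_system s l"
    using exists_half_system[OF assms(2)] by blast
  then interpret half_system s l .
  show "simple_of_type_B l (skew_alg (neg_mat :: 's gl_type))"
    unfolding simple_of_type_B_def simple_of_cartan_type_def
    using simple lie_finite_dimensional_skew_alg cartan_subalgebra_B[OF odd] root_base_B
      is_coroot_simple simple_root_coroot by blast
qed

end
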